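(* For integers $k>2$, $k\ge r\ge1$ and every $n\ge0$, $\overline{A}_0(1;2,k,r;n)=\overline{B}_0(1;2,k,r;n)$.
   Context: An overpartition of $n$ is a partition of $n$ in which the first occurrence of a part size may be overlined. Parts are totally ordered by $1<\bar1<2<\bar2<\cdots$; overpartitions are written $(\pi_1,\dots,\pi_s)$ with $\pi_i\ge\pi_{i+1}$ in this order, and all inequalities between parts are in this order, where $x+2$ denotes the part of size $|x|+2$ overlined iff $x$ is. $[x/2]=\lfloor|x|/2\rfloor$. $\overline{V}_\pi(N)$ is the number of overlined parts of $\pi$ that are $\le N$. $\overline{B}_0(1;2,k,r;n)$ is the number of overpartitions $(\pi_1,\dots,\pi_s)$ of $n$ such that only even parts may be non-overlined, $\pi_i\ge\pi_{i+k-1}+2$ (whenever $i+k-1\le s$) with strict inequality if $\pi_i$ is non-overlined, at most $r-1$ of the $\pi_i$ satisfy $\pi_i\le2$, and whenever $i+k-2\le s$ and $\pi_i\le\pi_{i+k-2}+2$ with strict inequality if $\pi_i$ is overlined, then $[\pi_i/2]+\cdots+[\pi_{i+k-2}/2]\equiv r-1+\overline{V}_\pi(\pi_i)\pmod2$. $\overline{A}_0(1;2,k,r;n)$ is the number of overpartitions of $n$ in which only even parts may be overlined, and the non-overlined parts are $\not\equiv2\pmod4$ and $\not\equiv0,\pm(2r-1)\pmod{4k-4}$. *)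

theory Defs
  imports "HOL-Library.Product_Lexorder" "HOL-Number_Theory.Cong"
begin

text \<open>
  A part is a pair of its size and a flag telling whether it is overlined.  The lexicographic
  order of \<^theory>\<open>HOL-Library.Product_Lexorder\<close> (with \<^prop>\<open>False < True\<close>) is the order
  in which 1 precedes overlined 1, which precedes 2, which precedes overlined 2, and so on.
\<close>

type_synonym part = "nat \<times> bool"

abbreviation part_size :: "part \<Rightarrow> nat" where
  "part_size \<equiv> fst"

abbreviation overlined :: "part \<Rightarrow> bool" where
  "overlined \<equiv> snd"

definition plus_two :: "part \<Rightarrow> part" where
  "plus_two x = (part_size x + 2, overlined x)"

definition overpartitions :: "nat \<Rightarrow> part list set" where
  "overpartitions n = {\<pi>.
     sorted_wrt (\<ge>) \<pi> \<and>
     (\<forall>x\<in>set \<pi>. part_size x > 0) \<and>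
     (\<forall>i<length \<pi>. overlined (\<pi> ! i) \<longrightarrow> (\<forall>j<i. part_size (\<pi> ! j) \<noteq> part_size (\<pi> ! i))) \<and>
     sum_list (map part_size \<pi>) = n}"

lemma finite_overpartitions: "finite (overpartitions n)"
proof -
  have len: "length \<pi> \<le> sum_list (map part_size \<pi>)" if "\<forall>x\<in>set \<pi>. part_size x > 0" for \<pi>
    using that by (induction \<pi>) auto
  have "overpartitions n \<subseteq> {\<pi>. set \<pi> \<subseteq> {..n} \<times> UNIV \<and> length \<pi> \<le> n}"
  proof
    fix \<pi> assume \<pi>: "\<pi> \<in> overpartitions n"
    then have "part_size x \<le> n" if "x \<in> set \<pi>" for x
      using that member_le_sum_list[of "part_size x" "map part_size \<pi>"]
      by (auto simp: overpartitions_def)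
    then show "\<pi> \<in> {\<pi>. set \<pi> \<subseteq> {..n} \<times> UNIV \<and> length \<pi> \<le> n}"
      using \<pi> len[of \<pi>] by (fastforce simp: overpartitions_def)
  qed
  moreover have "finite {\<pi>. set \<pi> \<subseteq> {..n} \<times> (UNIV :: bool set) \<and> length \<pi> \<le> n}"
    by (rule finite_lists_length_le) simp
  ultimately show ?thesis
    by (rule finite_subset)
qed

definition V_bar :: "part list \<Rightarrow> part \<Rightarrow> nat" where
  "V_bar \<pi> N = length (filter (\<lambda>x. overlined x \<and> x \<le> N) \<pi>)"

text \<open>List indices start at 0, so the condition that an index is at most the number of parts
  becomes a strict inequality.  The pair \<^term>\<open>(2, False)\<close> is the non-overlined part 2.\<close>

definition B_bar_set :: "nat \<Rightarrow> nat \<Rightarrow> nat \<Rightarrow> part list set" where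
  "B_bar_set k r n = {\<pi> \<in> overpartitions n.
     (\<forall>x\<in>set \<pi>. \<not> overlined x \<longrightarrow> even (part_size x)) \<and>
     (\<forall>i. i + (k - 1) < length \<pi> \<longrightarrow>
        \<pi> ! i \<ge> plus_two (\<pi> ! (i + (k - 1))) \<and>
        (\<not> overlined (\<pi> ! i) \<longrightarrow> \<pi> ! i > plus_two (\<pi> ! (i + (k - 1))))) \<and>
     length (filter (\<lambda>x. x \<le> (2, False)) \<pi>) \<le> r - 1 \<and>
     (\<forall>i. i + (k - 2) < length \<pi> \<and>
        \<pi> ! i \<le> plus_two (\<pi> ! (i + (k - 2))) \<and>
        (overlined (\<pi> ! i) \<longrightarrow> \<pi> ! i < plus_two (\<pi> ! (i + (k - 2)))) \<longrightarrow>
        [(\<Sum>j=i..i + (k - 2). part_size (\<pi> ! j) div 2) = r - 1 + V_bar \<pi> (\<pi> ! i)] (mod 2))}"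

definition B_bar :: "nat \<Rightarrow> nat \<Rightarrow> nat \<Rightarrow> nat" where
  "B_bar k r n = card (B_bar_set k r n)"

definition A_bar_set :: "nat \<Rightarrow> nat \<Rightarrow> nat \<Rightarrow> part list set" where
  "A_bar_set k r n = {\<pi> \<in> overpartitions n.
     (\<forall>x\<in>set \<pi>. overlined x \<longrightarrow> even (part_size x)) \<and>
     (\<forall>x\<in>set \<pi>. \<not> overlined x \<longrightarrow>
        \<not> [int (part_size x) = 2] (mod 4) \<and>
        \<not> [int (part_size x) = 0] (mod (4 * int k - 4)) \<and>
        \<not> [int (part_size x) = 2 * int r - 1] (mod (4 * int k - 4)) \<and>
        \<not> [int (part_size x) = - (2 * int r - 1)] (mod (4 * int k - 4)))}"

definition A_bar :: "nat \<Rightarrow> nat \<Rightarrow> nat \<Rightarrow> nat" where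
  "A_bar k r n = card (A_bar_set k r n)"

end

theory Submission
  imports Defs "HOL-Computational_Algebra.Formal_Power_Series"
begin

text \<open>
  Call an overpartition of the second kind with all parts larger than \<open>2 j\<close> and at most \<open>s\<close> parts
  up to \<open>2 j + 2\<close> an object of level \<open>j\<close>, and let \<open>H j s\<close> be the generating function of these objects,
  with the parity condition normalised to \<open>s + j (k - 1)\<close>.  Removing the parts of sizes \<open>2 j + 1\<close> and
  \<open>2 j + 2\<close> yields an object of level \<open>j + 1\<close>, and the parity condition conspires so that \<open>H j s - H j (s - 2)\<close>
  only involves removals of \<open>s\<close> or \<open>s - 1\<close> parts up to \<open>2 j + 2\<close>.  The resulting recurrence determines \<open>H\<close>,
  because \<open>H j s\<close> tends to 1 as \<open>j\<close> grows.  It is solved by the product of \<open>1 + q^(2 i)\<close> over \<open>i > j\<close> and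
  Andrews' function \<open>J\<close> of the generalised Goellnitz-Gordon identities with \<open>k - 1\<close> in place of \<open>k\<close>.
  At \<open>j = 0\<close> this function is a theta series over an infinite product, and the Jacobi triple product
  turns it into the generating function of the overpartitions of the first kind.
\<close>

unbundle fps_syntax

subsection \<open>Windows of consecutive parts\<close>

text \<open>The step by 2 in \<open>s\<close> is forced by the parity condition: the normalised
  constants of \<open>s\<close> and \<open>s - 2\<close> have the same parity, so the objects with
  at most \<open>s - 2\<close> small parts satisfy the very same condition at both indices, whereas
  \<open>s - 1\<close> would ask for the opposite one. All full windows that meet the removed parts
  impose one single congruence, on the number of removed parts up to the non-overlined
  \<open>2 j + 2\<close>; its failure merely shortens these windows by one. Andrews' function moves
  by step 1 in \<open>s\<close>, and two of its steps combined with the factor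
  \<open>1 + q^(2 j + 2)\<close> give the recurrence of step 2. Andrews' index stops one short of
  the top value \<open>s = k - 1\<close>, which therefore repeats \<open>s = k - 2\<close>; on the
  other side the residues of \<plusminus>(2r - 1) modulo 4k - 4 coincide for r = k and r = k - 1. No
  limits are taken. Series are compared modulo \<open>q^M\<close>: the recurrences express level
  \<open>j\<close> by smaller \<open>s\<close> and by level \<open>j + 1\<close>, and both solutions
  are 1 modulo \<open>q^j\<close>, so finitely many unfoldings determine each coefficient.\<close>

definition may_precede :: "part \<Rightarrow> part \<Rightarrow> bool" where
  "may_precede x y \<longleftrightarrow> y < x \<or> (y = x \<and> \<not> overlined x)"

abbreviation weight :: "part list \<Rightarrow> nat" where
  "weight \<pi> \<equiv> sum_list (map part_size \<pi>)"

text \<open>In decreasing order an overlined part stands before the non-overlined parts of its size,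
  so the first-occurrence rule becomes a relation between pairs of parts: only non-overlined parts
  may repeat.\<close>

lemma overpartitions_iff:
  "\<pi> \<in> overpartitions n \<longleftrightarrow>
     sorted_wrt may_precede \<pi> \<and> (\<forall>x\<in>set \<pi>. part_size x > 0) \<and> weight \<pi> = n"
proof -
  have "sorted_wrt (\<ge>) \<pi> \<and>
     (\<forall>i<length \<pi>. overlined (\<pi> ! i) \<longrightarrow> (\<forall>j<i. part_size (\<pi> ! j) \<noteq> part_size (\<pi> ! i))) \<longleftrightarrow>
     (\<forall>j i. j < i \<longrightarrow> i < length \<pi> \<longrightarrow> \<pi> ! i \<le> \<pi> ! j \<and>
        (overlined (\<pi> ! i) \<longrightarrow> part_size (\<pi> ! j) \<noteq> part_size (\<pi> ! i)))"
    unfolding sorted_wrt_iff_nth_less by blast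
  also have "\<dots> \<longleftrightarrow> sorted_wrt may_precede \<pi>"
  proof -
    have "y \<le> x \<and> (overlined y \<longrightarrow> part_size x \<noteq> part_size y) \<longleftrightarrow> may_precede x y" for x y :: part
      by (cases x; cases y) (auto simp: may_precede_def less_eq_prod_def less_prod_def)
    then show ?thesis unfolding sorted_wrt_iff_nth_less by blast
  qed
  finally show ?thesis unfolding overpartitions_def by blast
qed

text \<open>For \<open>y \<le> x\<close> this is at once the negation of the gap condition for parts
  at index distance \<open>k - 1\<close> and the premise of the parity condition for parts at
  distance \<open>k - 2\<close>. Counting the parts in a window thus expresses both conditions
  without indices.\<close>

definition window :: "part \<Rightarrow> part \<Rightarrow> bool" where
  "window x y \<longleftrightarrow> y \<le> x \<and> (x < plus_two y \<or> (\<not> overlined x \<and> x = plus_two y))"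

definition windows_ok :: "nat \<Rightarrow> nat \<Rightarrow> part list \<Rightarrow> bool" where
  "windows_ok k c \<pi> \<longleftrightarrow> (\<forall>x\<in>set \<pi>. length (filter (window x) \<pi>) \<le> k - 1 \<and>
     (length (filter (window x) \<pi>) = k - 1 \<longrightarrow>
        [(\<Sum>y\<leftarrow>filter (window x) \<pi>. part_size y div 2) = c + V_bar \<pi> x] (mod 2)))"

lemma window_mono:
  assumes "window x y'" "y' \<le> y" "y \<le> x"
  shows "window x y"
proof -
  have "plus_two y' \<le> plus_two y"
    using assms(2) by (auto simp: plus_two_def less_eq_prod_def)
  moreover have "x < plus_two y' \<or> (\<not> overlined x \<and> x = plus_two y')"
    using assms(1) unfolding window_def by blast
  ultimately have "x < plus_two y \<or> (\<not> overlined x \<and> x = plus_two y)"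
    using less_le_trans le_less by metis
  then show ?thesis
    using assms(3) unfolding window_def by blast
qed

lemma sorted_nth_ge:
  "sorted_wrt may_precede \<pi> \<Longrightarrow> i \<le> j \<Longrightarrow> j < length \<pi> \<Longrightarrow> \<pi> ! j \<le> \<pi> ! i"
  using sorted_wrt_nth_less[of may_precede \<pi> i j] unfolding may_precede_def
  by (cases "i = j") (auto intro: order_less_imp_le)

text \<open>By \<open>window_mono\<close>, in a decreasing list the parts in the window of
  \<open>x\<close> form a contiguous block. It begins at the first occurrence of \<open>x\<close>,
  since earlier parts are larger; at a later occurrence the earlier copies would belong to the
  window as well.\<close>

lemma filter_window_eq_take_drop:
  assumes \<pi>: "sorted_wrt may_precede \<pi>" and i: "i < length \<pi>" and first: "\<And>j. j < i \<Longrightarrow> \<pi> ! j \<noteq> \<pi> ! i"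
  defines "c \<equiv> length (filter (window (\<pi> ! i)) \<pi>)"
  shows "filter (window (\<pi> ! i)) \<pi> = take c (drop i \<pi>)"
    and "i + c \<le> length \<pi>"
    and "\<And>j. i \<le> j \<Longrightarrow> j < length \<pi> \<Longrightarrow> window (\<pi> ! i) (\<pi> ! j) \<longleftrightarrow> j < i + c"
proof -
  define x where "x = \<pi> ! i"
  have before: "filter (window x) (take i \<pi>) = []"
    unfolding filter_empty_conv
  proof
    fix y assume "y \<in> set (take i \<pi>)"
    then obtain j where j: "j < i" "y = \<pi> ! j" by (auto simp: in_set_conv_nth)
    have "x < y"
      using sorted_nth_ge[OF \<pi>, of j i] first[OF j(1)] i j by (simp add: x_def)
    then show "\<not> window x y" using leD[of y x] unfolding window_def by blast
  qed
  have "filter (window x) \<pi> = filter (window x) (take i \<pi> @ drop i \<pi>)"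
    by simp
  also have "\<dots> = filter (window x) (drop i \<pi>)"
    unfolding filter_append before by simp
  also have "\<dots> = takeWhile (window x) (drop i \<pi>)"
  proof (rule takeWhile_eq_filter[symmetric])
    fix y assume y: "y \<in> set (dropWhile (window x) (drop i \<pi>))"
    define d where "d = dropWhile (window x) (drop i \<pi>)"
    have "d \<noteq> []" using y unfolding d_def[symmetric] by (cases d) simp_all
    then have hd: "\<not> window x (hd d)" unfolding d_def by (rule hd_dropWhile)
    have sub: "set d \<subseteq> set (drop i \<pi>)" unfolding d_def by (auto dest: set_dropWhileD)
    have "sorted_wrt may_precede d"
      unfolding d_def dropWhile_eq_drop using \<pi> by (simp add: sorted_wrt_drop)
    then have "y \<le> hd d"
      using y \<open>d \<noteq> []\<close> unfolding d_def[symmetric] by (cases d) (auto simp: may_precede_def)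
    moreover have "hd d \<le> x"
    proof -
      have "hd d \<in> set (drop i \<pi>)" using sub \<open>d \<noteq> []\<close> by auto
      then obtain j where "j < length \<pi> - i" "hd d = \<pi> ! (i + j)" by (auto simp: in_set_conv_nth)
      then show ?thesis using sorted_nth_ge[OF \<pi>, of i "i + j"] by (simp add: x_def)
    qed
    ultimately show "\<not> window x y" using hd window_mono[of x y "hd d"] by blast
  qed
  finally have tw: "filter (window x) \<pi> = takeWhile (window x) (drop i \<pi>)" .
  show take: "filter (window (\<pi> ! i)) \<pi> = take c (drop i \<pi>)"
    unfolding c_def x_def[symmetric] tw by (rule takeWhile_eq_take)
  have "c \<le> length (drop i \<pi>)"
    unfolding c_def x_def[symmetric] tw by (rule length_takeWhile_le)
  then show c: "i + c \<le> length \<pi>" using i by simp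
  fix j assume j: "i \<le> j" "j < length \<pi>"
  show "window (\<pi> ! i) (\<pi> ! j) \<longleftrightarrow> j < i + c"
  proof
    assume "j < i + c"
    then have "take c (drop i \<pi>) ! (j - i) = \<pi> ! j" "j - i < length (take c (drop i \<pi>))"
      using j c by auto
    then have "\<pi> ! j \<in> set (filter (window (\<pi> ! i)) \<pi>)"
      unfolding take by (metis nth_mem[of "j - i"])
    then show "window (\<pi> ! i) (\<pi> ! j)" by simp
  next
    assume w: "window (\<pi> ! i) (\<pi> ! j)"
    show "j < i + c"
    proof (rule ccontr)
      assume "\<not> j < i + c"
      then have n: "c < length (drop i \<pi>)" and ij: "i + c \<le> j" using j by auto
      have "\<not> window x (drop i \<pi> ! c)"
        using nth_length_takeWhile[of "window x" "drop i \<pi>"] n unfolding c_def x_def[symmetric] tw by simp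
      moreover have "drop i \<pi> ! c = \<pi> ! (i + c)" using i by simp
      moreover have "window x (\<pi> ! (i + c))"
        unfolding x_def
      proof (rule window_mono[OF w])
        show "\<pi> ! j \<le> \<pi> ! (i + c)" by (rule sorted_nth_ge[OF \<pi> ij j(2)])
        show "\<pi> ! (i + c) \<le> \<pi> ! i" using ij j(2) by (intro sorted_nth_ge[OF \<pi>]) auto
      qed
      ultimately show False by simp
    qed
  qed
qed

lemma first_occurrence:
  assumes "i < length \<pi>"
  obtains i0 where "i0 \<le> i" "\<pi> ! i0 = \<pi> ! i" "\<And>j. j < i0 \<Longrightarrow> \<pi> ! j \<noteq> \<pi> ! i0"
proof
  define i0 where "i0 = (LEAST j. \<pi> ! j = \<pi> ! i)"
  show eq: "\<pi> ! i0 = \<pi> ! i" unfolding i0_def by (rule LeastI) simp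
  show "i0 \<le> i" unfolding i0_def by (rule Least_le) simp
  show "\<pi> ! j \<noteq> \<pi> ! i0" if "j < i0" for j
    using that not_less_Least[of j "\<lambda>j. \<pi> ! j = \<pi> ! i"] unfolding i0_def[symmetric] eq by simp
qed

lemma less_or_eq_iff:
  fixes x p :: "'a::linorder"
  shows "(x \<le> p \<and> (b \<longrightarrow> x < p)) \<longleftrightarrow> (x < p \<or> (\<not> b \<and> x = p))"
  by auto

lemma not_less_or_eq_iff:
  fixes x p :: "'a::linorder"
  shows "(p \<le> x \<and> (\<not> b \<longrightarrow> p < x)) \<longleftrightarrow> \<not> (x < p \<or> (\<not> b \<and> x = p))"
  by auto

text \<open>
  Both index conditions only matter where \<open>\<pi> ! i\<close> occurs for the first time: \<open>k - 1\<close> parts in the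
  window of a later occurrence would make, with the first one, \<open>k\<close> parts in the window.
\<close>
lemma index_conditions_iff_windows_ok:
  assumes \<pi>: "sorted_wrt may_precede \<pi>" and k: "k > 2"
  shows "(\<forall>i. i + (k - 1) < length \<pi> \<longrightarrow>
        \<pi> ! i \<ge> plus_two (\<pi> ! (i + (k - 1))) \<and>
        (\<not> overlined (\<pi> ! i) \<longrightarrow> \<pi> ! i > plus_two (\<pi> ! (i + (k - 1))))) \<and>
     (\<forall>i. i + (k - 2) < length \<pi> \<and>
        \<pi> ! i \<le> plus_two (\<pi> ! (i + (k - 2))) \<and>
        (overlined (\<pi> ! i) \<longrightarrow> \<pi> ! i < plus_two (\<pi> ! (i + (k - 2)))) \<longrightarrow>
        [(\<Sum>j=i..i + (k - 2). part_size (\<pi> ! j) div 2) = c + V_bar \<pi> (\<pi> ! i)] (mod 2))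
    \<longleftrightarrow> windows_ok k c \<pi>" (is "?gap \<and> ?parity \<longleftrightarrow> _")
proof -
  have gap: "?gap \<longleftrightarrow> (\<forall>i. i + (k - 1) < length \<pi> \<longrightarrow> \<not> window (\<pi> ! i) (\<pi> ! (i + (k - 1))))"
  proof -
    have eq: "\<pi> ! i \<ge> plus_two y \<and> (\<not> overlined (\<pi> ! i) \<longrightarrow> \<pi> ! i > plus_two y) \<longleftrightarrow> \<not> window (\<pi> ! i) y"
      if "y \<le> \<pi> ! i" for i y
      using that unfolding window_def not_less_or_eq_iff by blast
    have "(i + (k - 1) < length \<pi> \<longrightarrow> \<pi> ! i \<ge> plus_two (\<pi> ! (i + (k - 1))) \<and>
        (\<not> overlined (\<pi> ! i) \<longrightarrow> \<pi> ! i > plus_two (\<pi> ! (i + (k - 1))))) \<longleftrightarrow>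
      (i + (k - 1) < length \<pi> \<longrightarrow> \<not> window (\<pi> ! i) (\<pi> ! (i + (k - 1))))" for i
    proof (cases "i + (k - 1) < length \<pi>")
      case True
      show ?thesis
        unfolding eq[OF sorted_nth_ge[OF \<pi> le_add1 True]] ..
    qed blast
    then show ?thesis by (simp only:)
  qed
  have parity: "?parity \<longleftrightarrow> (\<forall>i. i + (k - 2) < length \<pi> \<longrightarrow> window (\<pi> ! i) (\<pi> ! (i + (k - 2))) \<longrightarrow>
     [(\<Sum>j=i..i + (k - 2). part_size (\<pi> ! j) div 2) = c + V_bar \<pi> (\<pi> ! i)] (mod 2))"
  proof -
    have eq: "\<pi> ! i \<le> plus_two y \<and> (overlined (\<pi> ! i) \<longrightarrow> \<pi> ! i < plus_two y) \<longleftrightarrow> window (\<pi> ! i) y"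
      if "y \<le> \<pi> ! i" for i y
      using that unfolding window_def less_or_eq_iff by blast
    have "(i + (k - 2) < length \<pi> \<and> \<pi> ! i \<le> plus_two (\<pi> ! (i + (k - 2))) \<and>
        (overlined (\<pi> ! i) \<longrightarrow> \<pi> ! i < plus_two (\<pi> ! (i + (k - 2)))) \<longrightarrow> D) \<longleftrightarrow>
      (i + (k - 2) < length \<pi> \<longrightarrow> window (\<pi> ! i) (\<pi> ! (i + (k - 2))) \<longrightarrow> D)" for i D
    proof (cases "i + (k - 2) < length \<pi>")
      case True
      show ?thesis
        unfolding eq[OF sorted_nth_ge[OF \<pi> le_add1 True]] using True by blast
    qed blast
    then show ?thesis by (simp only:)
  qed
  have sum_eq: "(\<Sum>y\<leftarrow>take (k - 1) (drop i \<pi>). part_size y div 2) = (\<Sum>j=i..i + (k - 2). part_size (\<pi> ! j) div 2)"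
    if "i + (k - 2) < length \<pi>" for i
  proof -
    have "(\<Sum>y\<leftarrow>take (k - 1) (drop i \<pi>). part_size y div 2) = (\<Sum>j = 0..<k - 1. part_size (\<pi> ! (j + i)) div 2)"
      using that k by (simp add: sum_list_sum_nth add.commute)
    also have "\<dots> = (\<Sum>j = i..<i + (k - 1). part_size (\<pi> ! j) div 2)"
      using sum.shift_bounds_nat_ivl[of "\<lambda>j. part_size (\<pi> ! j) div 2" 0 i "k - 1"] by (simp add: add.commute)
    also have "{i..<i + (k - 1)} = {i..i + (k - 2)}" using k by auto
    finally show ?thesis .
  qed
  show ?thesis
    unfolding gap parity
  proof
    assume *: "(\<forall>i. i + (k - 1) < length \<pi> \<longrightarrow> \<not> window (\<pi> ! i) (\<pi> ! (i + (k - 1)))) \<and>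
      (\<forall>i. i + (k - 2) < length \<pi> \<longrightarrow> window (\<pi> ! i) (\<pi> ! (i + (k - 2))) \<longrightarrow>
     [(\<Sum>j=i..i + (k - 2). part_size (\<pi> ! j) div 2) = c + V_bar \<pi> (\<pi> ! i)] (mod 2))"
    show "windows_ok k c \<pi>"
      unfolding windows_ok_def
    proof
      fix x assume "x \<in> set \<pi>"
      then obtain i' where "i' < length \<pi>" "\<pi> ! i' = x" by (auto simp: in_set_conv_nth)
      then obtain i where i: "i < length \<pi>" "\<pi> ! i = x" "\<And>j. j < i \<Longrightarrow> \<pi> ! j \<noteq> \<pi> ! i"
        using first_occurrence[of i' \<pi>] by (metis le_less_trans)
      note block = filter_window_eq_take_drop[OF \<pi> i(1,3), unfolded i(2)]
      define c' where "c' = length (filter (window x) \<pi>)"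
      have "c' \<le> k - 1"
      proof (rule ccontr)
        assume "\<not> c' \<le> k - 1"
        then have "i + (k - 1) < i + c'" by simp
        then show False
          using block(2) block(3)[of "i + (k - 1)"] *[THEN conjunct1, rule_format, of i] i(2)
          unfolding c'_def by simp
      qed
      moreover have "[(\<Sum>y\<leftarrow>filter (window x) \<pi>. part_size y div 2) = c + V_bar \<pi> x] (mod 2)" if "c' = k - 1"
      proof -
        have lt: "i + (k - 2) < i + c'" using that k by simp
        then have "i + (k - 2) < length \<pi>" "window x (\<pi> ! (i + (k - 2)))"
          using block(2) block(3)[of "i + (k - 2)"] unfolding c'_def by auto
        then show ?thesis
          using *[THEN conjunct2, rule_format, of i] i(2) sum_eq[of i] block(1) that unfolding c'_def by simp
      qed
      ultimately show "length (filter (window x) \<pi>) \<le> k - 1 \<and>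
        (length (filter (window x) \<pi>) = k - 1 \<longrightarrow>
        [(\<Sum>y\<leftarrow>filter (window x) \<pi>. part_size y div 2) = c + V_bar \<pi> x] (mod 2))"
        unfolding c'_def by blast
    qed
  next
    assume ok: "windows_ok k c \<pi>"
    have win_lt: "j < i0 + (k - 1)" if "window (\<pi> ! i) (\<pi> ! j)" "i \<le> j" "j < length \<pi>"
      "i0 \<le> i" "\<pi> ! i0 = \<pi> ! i" "\<And>j. j < i0 \<Longrightarrow> \<pi> ! j \<noteq> \<pi> ! i0" for i j i0
    proof -
      have i0: "i0 < length \<pi>" using that by simp
      have "length (filter (window (\<pi> ! i0)) \<pi>) \<le> k - 1"
        using ok i0 unfolding windows_ok_def by simp
      then show ?thesis
        using filter_window_eq_take_drop(3)[OF \<pi> i0 that(6), of j] that by auto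
    qed
    show "(\<forall>i. i + (k - 1) < length \<pi> \<longrightarrow> \<not> window (\<pi> ! i) (\<pi> ! (i + (k - 1)))) \<and>
      (\<forall>i. i + (k - 2) < length \<pi> \<longrightarrow> window (\<pi> ! i) (\<pi> ! (i + (k - 2))) \<longrightarrow>
     [(\<Sum>j=i..i + (k - 2). part_size (\<pi> ! j) div 2) = c + V_bar \<pi> (\<pi> ! i)] (mod 2))"
    proof (intro conjI allI impI notI)
      fix i assume i: "i + (k - 1) < length \<pi>" and w: "window (\<pi> ! i) (\<pi> ! (i + (k - 1)))"
      obtain i0 where "i0 \<le> i" "\<pi> ! i0 = \<pi> ! i" "\<And>j. j < i0 \<Longrightarrow> \<pi> ! j \<noteq> \<pi> ! i0"
        using first_occurrence[of i \<pi>] i by auto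
      from win_lt[OF w _ i this] this(1) show False by simp
    next
      fix i assume i: "i + (k - 2) < length \<pi>" and w: "window (\<pi> ! i) (\<pi> ! (i + (k - 2)))"
      obtain i0 where i0: "i0 \<le> i" "\<pi> ! i0 = \<pi> ! i" "\<And>j. j < i0 \<Longrightarrow> \<pi> ! j \<noteq> \<pi> ! i0"
        using first_occurrence[of i \<pi>] i by auto
      have "i + (k - 2) < i0 + (k - 1)" using win_lt[OF w _ i i0] by simp
      then have [simp]: "i0 = i" using i0(1) k by simp
      have i': "i < length \<pi>" using i by simp
      note block = filter_window_eq_take_drop[OF \<pi> i' i0(3)[simplified]]
      have "length (filter (window (\<pi> ! i)) \<pi>) \<le> k - 1"
        using ok i' unfolding windows_ok_def by simp
      moreover have "i + (k - 2) < i + length (filter (window (\<pi> ! i)) \<pi>)"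
        using block(3)[of "i + (k - 2)"] w i by simp
      ultimately have len: "length (filter (window (\<pi> ! i)) \<pi>) = k - 1" by simp
      then have "[(\<Sum>y\<leftarrow>filter (window (\<pi> ! i)) \<pi>. part_size y div 2) = c + V_bar \<pi> (\<pi> ! i)] (mod 2)"
        using ok i' unfolding windows_ok_def by simp
      then show "[(\<Sum>j=i..i + (k - 2). part_size (\<pi> ! j) div 2) = c + V_bar \<pi> (\<pi> ! i)] (mod 2)"
        using block(1) len sum_eq[OF i] by simp
    qed
  qed
qed

subsection \<open>Splitting off the smallest parts\<close>

text \<open>
  The number \<open>c\<close> stands for \<open>r - 1\<close> plus the number of overlined parts removed at lower levels; only its
  parity matters.
\<close>
definition level_set :: "nat \<Rightarrow> nat \<Rightarrow> nat \<Rightarrow> nat \<Rightarrow> part list set" where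
  "level_set k j s c = {\<pi>. sorted_wrt may_precede \<pi> \<and>
     (\<forall>x\<in>set \<pi>. 2 * j < part_size x \<and> (\<not> overlined x \<longrightarrow> even (part_size x))) \<and>
     length (filter (\<lambda>x. x \<le> (2 * j + 2, False)) \<pi>) \<le> s \<and> windows_ok k c \<pi>}"

lemma B_bar_set_eq_level_set:
  assumes "k > 2"
  shows "B_bar_set k r n = {\<pi> \<in> level_set k 0 (r - 1) (r - 1). weight \<pi> = n}"
proof (rule set_eqI)
  fix \<pi>
  show "\<pi> \<in> B_bar_set k r n \<longleftrightarrow> \<pi> \<in> {\<pi> \<in> level_set k 0 (r - 1) (r - 1). weight \<pi> = n}"
  proof (cases "sorted_wrt may_precede \<pi>")
    case True
    show ?thesis
      unfolding B_bar_set_def level_set_def overpartitions_iff mem_Collect_eq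
        index_conditions_iff_windows_ok[OF True assms, symmetric] mult_0_right add_0_left ball_conj_distrib
      by (simp only: conj_ac)
  next
    case False
    then show ?thesis by (simp add: B_bar_set_def level_set_def overpartitions_iff)
  qed
qed

lemma level_set_cong: "[c = c'] (mod 2) \<Longrightarrow> level_set k j s c = level_set k j s c'"
proof -
  assume "[c = c'] (mod 2)"
  then have "[a = c + v] (mod 2) \<longleftrightarrow> [a = c' + v] (mod 2)" for a v
    by (meson cong_add_rcancel_nat cong_sym cong_trans)
  then show ?thesis by (simp add: level_set_def windows_ok_def)
qed

text \<open>\<open>u\<close>, \<open>f\<close>, \<open>v\<close> are multiplicities. A non-overlined
  part \<open>2 j + 1\<close> does not appear because non-overlined parts are even.\<close>

definition tail :: "nat \<Rightarrow> nat \<times> nat \<times> nat \<Rightarrow> part list" where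
  "tail j = (\<lambda>(u, f, v). replicate v (2 * j + 2, True) @ replicate f (2 * j + 2, False) @
     replicate u (2 * j + 1, True))"

text \<open>Peels off all copies of the least part that can occur. Repeated use reads off the
  multiplicities of the smallest parts one value at a time.\<close>

lemma split_off_least:
  assumes "sorted_wrt may_precede \<pi>" "\<And>x. x \<in> set \<pi> \<Longrightarrow> z \<le> x"
  shows "\<exists>\<pi>' m. \<pi> = \<pi>' @ replicate m z \<and> sorted_wrt may_precede \<pi>' \<and> (\<forall>x\<in>set \<pi>'. z < x)"
  using assms
proof (induction \<pi> rule: rev_induct)
  case Nil
  show ?case by (rule exI[of _ "[]"], rule exI[of _ 0]) simp
next
  case (snoc y \<pi>)
  then have s: "sorted_wrt may_precede \<pi>" "\<And>x. x \<in> set \<pi> \<Longrightarrow> may_precede x y"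
    by (auto simp: sorted_wrt_append)
  show ?case
  proof (cases "y = z")
    case True
    obtain \<pi>' m where "\<pi> = \<pi>' @ replicate m z" "sorted_wrt may_precede \<pi>'" "\<forall>x\<in>set \<pi>'. z < x"
      using snoc.IH[OF s(1)] snoc.prems(2) by auto
    then have "\<pi> @ [y] = \<pi>' @ replicate (Suc m) z" "sorted_wrt may_precede \<pi>'" "\<forall>x\<in>set \<pi>'. z < x"
      using True by (auto simp: replicate_append_same)
    then show ?thesis by blast
  next
    case False
    then have "z < y" using snoc.prems(2)[of y] by simp
    then have "\<forall>x\<in>set (\<pi> @ [y]). z < x"
      using s(2) unfolding may_precede_def by (auto intro: less_trans)
    then show ?thesis
      using snoc.prems(1) by (intro exI[of _ "\<pi> @ [y]"] exI[of _ 0]) simp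
  qed
qed

lemma sorted_wrt_may_precede_append_replicate:
  "sorted_wrt may_precede (\<pi> @ replicate m z) \<longleftrightarrow>
     sorted_wrt may_precede \<pi> \<and> (m > 0 \<longrightarrow> (\<forall>x\<in>set \<pi>. may_precede x z)) \<and> (overlined z \<longrightarrow> m \<le> 1)"
proof -
  have "sorted_wrt may_precede (replicate m z) \<longleftrightarrow> (overlined z \<longrightarrow> m \<le> 1)"
    by (induction m) (auto simp: may_precede_def)
  then show ?thesis by (auto simp: sorted_wrt_append)
qed

lemma sorted_append_tail:
  assumes "\<And>x. x \<in> set \<pi> \<Longrightarrow> 2 * j + 2 < part_size x"
  shows "sorted_wrt may_precede (\<pi> @ tail j (u, f, v)) \<longleftrightarrow> sorted_wrt may_precede \<pi> \<and> u \<le> 1 \<and> v \<le> 1"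
proof -
  have "may_precede x z" if "x \<in> set \<pi>" "part_size z \<le> 2 * j + 2" for x z
    using assms[OF that(1)] that(2) by (simp add: may_precede_def less_prod_def)
  then have "\<forall>x\<in>set \<pi>. may_precede x (2 * j + 2, b) \<and> may_precede x (2 * j + 1, b)" for b
    by simp
  moreover have "may_precede (2 * j + 2, True) (2 * j + 2, False)" "may_precede (2 * j + 2, b) (2 * j + 1, True)" for b
    by (simp_all add: may_precede_def less_prod_def)
  ultimately show ?thesis
    unfolding tail_def prod.case append_assoc[symmetric] sorted_wrt_may_precede_append_replicate set_append ball_Un
    by auto
qed

text \<open>As odd parts must be overlined, the least candidates above \<open>2 j\<close> are
  consecutive in the order: overlined \<open>2 j + 1\<close>, then \<open>2 j + 2\<close>, then
  overlined \<open>2 j + 2\<close>. Each peeling leaves the next of them as the lower bound.\<close>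

lemma exists_tail:
  assumes "sorted_wrt may_precede \<pi>" "\<forall>x\<in>set \<pi>. 2 * j < part_size x \<and> (\<not> overlined x \<longrightarrow> even (part_size x))"
  obtains \<pi>' u f v where "\<pi> = \<pi>' @ tail j (u, f, v)" "\<And>x. x \<in> set \<pi>' \<Longrightarrow> 2 * j + 2 < part_size x"
proof -
  have le: "(2 * j + 1, True) \<le> x" if "x \<in> set \<pi>" for x
  proof (cases x)
    case (Pair m b)
    have "2 * j < m" "\<not> b \<longrightarrow> even m" using assms(2) that Pair by auto
    moreover have "m \<noteq> 2 * j + 1" if "\<not> b" using calculation that by auto
    ultimately show ?thesis unfolding Pair by (cases b) (auto simp: less_eq_prod_def less_prod_def)
  qed
  obtain \<pi>1 u where 1: "\<pi> = \<pi>1 @ replicate u (2 * j + 1, True)" "sorted_wrt may_precede \<pi>1"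
    "\<forall>x\<in>set \<pi>1. (2 * j + 1, True) < x"
    using split_off_least[OF assms(1) le] by blast
  have "(2 * j + 2, False) \<le> x" if "x \<in> set \<pi>1" for x
    using 1(3) that by (cases x) (auto simp: less_eq_prod_def less_prod_def)
  then obtain \<pi>2 f where 2: "\<pi>1 = \<pi>2 @ replicate f (2 * j + 2, False)" "sorted_wrt may_precede \<pi>2"
    "\<forall>x\<in>set \<pi>2. (2 * j + 2, False) < x"
    using split_off_least[OF 1(2), of "(2 * j + 2, False)"] by blast
  have "(2 * j + 2, True) \<le> x" if "x \<in> set \<pi>2" for x
    using 2(3) that by (cases x) (auto simp: less_eq_prod_def less_prod_def)
  then obtain \<pi>3 v where 3: "\<pi>2 = \<pi>3 @ replicate v (2 * j + 2, True)"
    "\<forall>x\<in>set \<pi>3. (2 * j + 2, True) < x"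
    using split_off_least[OF 2(2), of "(2 * j + 2, True)"] by blast
  have "2 * j + 2 < part_size x" if "x \<in> set \<pi>3" for x
    using 3(2) that by (cases x) (auto simp: less_prod_def)
  then show ?thesis
    using that[of \<pi>3 u f v] 1 2 3 by (simp add: tail_def)
qed

text \<open>Here \<open>t\<close> is the number of parts up to the non-overlined
  \<open>2 j + 2\<close>. If the congruence fails, windows touching the tail cannot be full, so the
  defect is what must be subtracted from the bound \<open>k - 1\<close> on their lengths.\<close>

definition parity_defect :: "nat \<Rightarrow> nat \<Rightarrow> nat \<Rightarrow> nat \<Rightarrow> nat" where
  "parity_defect k j c t = (if [t = c + (k - 1) * j] (mod 2) then 0 else 1)"

text \<open>
  A full window, whether it ends inside the tail or reaches into the next level, always imposes the
  same parity condition, namely that the defect vanishes.  Here \<open>o3\<close> and \<open>f4\<close> are the multiplicities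
  of the overlined part \<open>2 j + 3\<close> and of the non-overlined part \<open>2 j + 4\<close>.
\<close>
lemma windows_ok_append_tail_aux:
  fixes k j c u f v o3 f4 :: nat
  assumes k: "k > 2" and le: "u \<le> 1" "v \<le> 1" "o3 \<le> 1"
  defines "\<delta> \<equiv> parity_defect k j c (u + f)"
  shows "((f4 > 0 \<longrightarrow> f4 + o3 + v + f \<le> k - 1 \<and> (f4 + o3 + v + f = k - 1 \<longrightarrow>
            [f4 * (j + 2) + (o3 + v + f) * (j + 1) = c + (o3 + v + u)] (mod 2))) \<and>
      (o3 > 0 \<longrightarrow> o3 + v + f \<le> k - 1 \<and> (o3 + v + f = k - 1 \<longrightarrow>
            [(o3 + v + f) * (j + 1) = c + (o3 + v + u)] (mod 2))) \<and>
      (v > 0 \<longrightarrow> v + f + u \<le> k - 1 \<and> (v + f + u = k - 1 \<longrightarrow>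
            [(v + f) * (j + 1) + u * j = c + (v + u)] (mod 2))) \<and>
      (f > 0 \<longrightarrow> f + u \<le> k - 1 \<and> (f + u = k - 1 \<longrightarrow> [f * (j + 1) + u * j = c + u] (mod 2)))) \<longleftrightarrow>
     (u + f + v + \<delta> \<le> k - 1 \<and> f4 + o3 \<le> k - 1 - \<delta> - f - v \<and>
      (f4 > 0 \<longrightarrow> f4 + o3 \<le> k - 1 \<and> (f4 + o3 = k - 1 \<longrightarrow>
         [f4 * (j + 2) + o3 * (j + 1) = c + u + v + o3] (mod 2))))"
proof -
  define \<kappa> where "\<kappa> = (k - 1) * j"
  define E where "E \<longleftrightarrow> (even (u + f) \<longleftrightarrow> even (c + \<kappa>))"
  have cong: "[a = b] (mod 2) \<longleftrightarrow> (even a \<longleftrightarrow> even b)" for a b :: nat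
    by (simp add: cong_def even_iff_mod_2_eq_zero) presburger
  \<comment> \<open>In a full window the \<open>k - 1\<close> contributions of \<open>j\<close> add
    up to \<open>\<kappa>\<close>. Modulo 2 the part \<open>2 j + 4\<close> adds nothing more, and
    the overlined parts \<open>2 j + 3\<close> and \<open>2 j + 2\<close> add 1 to both sides. What
    remains is always \<open>\<kappa> + f = c + u\<close> modulo 2, which is
    \<open>E\<close>.\<close>
  have 1: "[f4 * (j + 2) + (o3 + v + f) * (j + 1) = c + (o3 + v + u)] (mod 2) \<longleftrightarrow> E"
    if "f4 + o3 + v + f = k - 1"
  proof -
    have "f4 * (j + 2) + (o3 + v + f) * (j + 1) = \<kappa> + 2 * f4 + o3 + v + f"
      unfolding \<kappa>_def that[symmetric] by (simp add: algebra_simps)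
    then show ?thesis unfolding cong E_def by presburger
  qed
  have 2: "[(o3 + v + f) * (j + 1) = c + (o3 + v + u)] (mod 2) \<longleftrightarrow> E" if "o3 + v + f = k - 1"
  proof -
    have "(o3 + v + f) * (j + 1) = \<kappa> + o3 + v + f"
      unfolding \<kappa>_def that[symmetric] by (simp add: algebra_simps)
    then show ?thesis unfolding cong E_def by presburger
  qed
  have 3: "[(v + f) * (j + 1) + u * j = c + (v + u)] (mod 2) \<longleftrightarrow> E" if "v + f + u = k - 1"
  proof -
    have "(v + f) * (j + 1) + u * j = \<kappa> + v + f"
      unfolding \<kappa>_def that[symmetric] by (simp add: algebra_simps)
    then show ?thesis unfolding cong E_def by presburger
  qed
  have 4: "[f * (j + 1) + u * j = c + u] (mod 2) \<longleftrightarrow> E" if "f + u = k - 1"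
  proof -
    have "f * (j + 1) + u * j = \<kappa> + f"
      unfolding \<kappa>_def that[symmetric] by (simp add: algebra_simps)
    then show ?thesis unfolding cong E_def by presburger
  qed
  have 5: "[f4 * (j + 2) + o3 * (j + 1) = c + u + v + o3] (mod 2) \<longleftrightarrow> E" if "f4 + o3 = k - 1" "f = 0" "v = 0"
  proof -
    have "f4 * (j + 2) + o3 * (j + 1) = \<kappa> + 2 * f4 + o3"
      unfolding \<kappa>_def that(1)[symmetric] by (simp add: algebra_simps)
    then show ?thesis using that(2,3) unfolding cong E_def by presburger
  qed
  have \<delta>: "\<delta> = (if E then 0 else 1)"
    unfolding \<delta>_def parity_defect_def cong E_def \<kappa>_def by simp
  have l: "(f4 + o3 + v + f = k - 1 \<longrightarrow> [f4 * (j + 2) + (o3 + v + f) * (j + 1) = c + (o3 + v + u)] (mod 2))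
        \<longleftrightarrow> (f4 + o3 + v + f = k - 1 \<longrightarrow> E)"
    "(o3 + v + f = k - 1 \<longrightarrow> [(o3 + v + f) * (j + 1) = c + (o3 + v + u)] (mod 2)) \<longleftrightarrow> (o3 + v + f = k - 1 \<longrightarrow> E)"
    "(v + f + u = k - 1 \<longrightarrow> [(v + f) * (j + 1) + u * j = c + (v + u)] (mod 2)) \<longleftrightarrow> (v + f + u = k - 1 \<longrightarrow> E)"
    "(f + u = k - 1 \<longrightarrow> [f * (j + 1) + u * j = c + u] (mod 2)) \<longleftrightarrow> (f + u = k - 1 \<longrightarrow> E)"
    using 1 2 3 4 by blast+
  \<comment> \<open>A full window of \<open>2 j + 4\<close> in the remaining list exhausts the new
    bound, which forces \<open>\<delta> = f = v = 0\<close>; its own parity condition is then a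
    consequence of \<open>E\<close>.\<close>
  have r: "[f4 * (j + 2) + o3 * (j + 1) = c + u + v + o3] (mod 2)"
    if "f4 + o3 = k - 1" "u + f + v + \<delta> \<le> k - 1" "f4 + o3 \<le> k - 1 - \<delta> - f - v"
  proof -
    have "\<delta> = 0" "f = 0" "v = 0" using that by linarith+
    then show ?thesis using 5 that(1) \<delta> by (auto split: if_splits)
  qed
  have "(u + f + v + \<delta> \<le> k - 1 \<and> f4 + o3 \<le> k - 1 - \<delta> - f - v \<and>
      (f4 > 0 \<longrightarrow> f4 + o3 \<le> k - 1 \<and> (f4 + o3 = k - 1 \<longrightarrow>
         [f4 * (j + 2) + o3 * (j + 1) = c + u + v + o3] (mod 2)))) \<longleftrightarrow>
    u + f + v + \<delta> \<le> k - 1 \<and> f4 + o3 \<le> k - 1 - \<delta> - f - v"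
    using r by auto
  moreover have "((f4 > 0 \<longrightarrow> f4 + o3 + v + f \<le> k - 1 \<and> (f4 + o3 + v + f = k - 1 \<longrightarrow> E)) \<and>
      (o3 > 0 \<longrightarrow> o3 + v + f \<le> k - 1 \<and> (o3 + v + f = k - 1 \<longrightarrow> E)) \<and>
      (v > 0 \<longrightarrow> v + f + u \<le> k - 1 \<and> (v + f + u = k - 1 \<longrightarrow> E)) \<and>
      (f > 0 \<longrightarrow> f + u \<le> k - 1 \<and> (f + u = k - 1 \<longrightarrow> E))) \<longleftrightarrow>
     (u + f + v + \<delta> \<le> k - 1 \<and> f4 + o3 \<le> k - 1 - \<delta> - f - v)"
  proof -
    have "(n \<le> k - 1 \<and> (n = k - 1 \<longrightarrow> E)) \<longleftrightarrow> n + \<delta> \<le> k - 1" for n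
      using \<delta> by auto
    moreover have "\<delta> \<le> 1" using \<delta> by simp
    moreover have "u = 0 \<or> u = 1" "v = 0 \<or> v = 1" "o3 = 0 \<or> o3 = 1" using le by auto
    moreover obtain k' where "k = k' + 3" using k le_Suc_ex[of 3 k] by (auto simp: add.commute)
    ultimately show ?thesis
      by (simp only:) (cases "f4 = 0"; cases "f = 0"; elim disjE; simp; linarith)
  qed
  ultimately show ?thesis unfolding l by (simp only:)
qed

definition window_ok :: "nat \<Rightarrow> nat \<Rightarrow> part list \<Rightarrow> part \<Rightarrow> bool" where
  "window_ok k c \<pi> x \<longleftrightarrow> length (filter (window x) \<pi>) \<le> k - 1 \<and>
     (length (filter (window x) \<pi>) = k - 1 \<longrightarrow>
        [(\<Sum>y\<leftarrow>filter (window x) \<pi>. part_size y div 2) = c + V_bar \<pi> x] (mod 2))"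

lemma windows_ok_iff: "windows_ok k c \<pi> \<longleftrightarrow> (\<forall>x\<in>set \<pi>. window_ok k c \<pi> x)"
  by (simp add: windows_ok_def window_ok_def)

text \<open>Only the windows of \<open>2 j + 4\<close> and overlined \<open>2 j + 3\<close> reach
  from the remaining list into the tail, and they reach exactly its parts of size
  \<open>2 j + 2\<close>. This turns the bound on their lengths into the new bound on small parts.
  Larger parts notice the tail only through \<open>V_bar\<close>, which grows by
  \<open>u + v\<close>. The windows of overlined \<open>2 j + 1\<close>, and of overlined
  \<open>2 j + 3\<close> without the tail, hold at most one part and are never full because
  \<open>k - 1 > 1\<close>.\<close>

lemma windows_ok_append_tail:
  fixes k j c u f v :: nat
  assumes k: "k > 2" and uv: "u \<le> 1" "v \<le> 1" and sorted: "sorted_wrt may_precede \<pi>"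
    and \<pi>: "\<forall>x\<in>set \<pi>. 2 * j + 2 < part_size x \<and> (\<not> overlined x \<longrightarrow> even (part_size x))"
  defines "\<delta> \<equiv> parity_defect k j c (u + f)"
  shows "windows_ok k c (\<pi> @ tail j (u, f, v)) \<longleftrightarrow> u + f + v + \<delta> \<le> k - 1 \<and>
    length (filter (\<lambda>x. x \<le> (2 * (j + 1) + 2, False)) \<pi>) \<le> k - 1 - \<delta> - f - v \<and>
    windows_ok k (c + u + v) \<pi>"
proof -
  define a4 :: part where "a4 = (2 * j + 4, False)"
  define a3 :: part where "a3 = (2 * j + 3, True)"
  define b2 :: part where "b2 = (2 * j + 2, True)"
  define b1 :: part where "b1 = (2 * j + 2, False)"
  define b0 :: part where "b0 = (2 * j + 1, True)"
  note defs = a4_def a3_def b2_def b1_def b0_def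
  have "a3 \<le> x" if "x \<in> set \<pi>" for x
  proof (cases x)
    case (Pair m b)
    then have "2 * j + 2 < m" "\<not> b \<longrightarrow> even m" using \<pi> that by auto
    moreover have "m \<noteq> 2 * j + 3" if "\<not> b" using calculation that by auto
    ultimately show ?thesis unfolding Pair a3_def by (cases b) (auto simp: less_eq_prod_def less_prod_def)
  qed
  then obtain \<rho> o3 where \<rho>: "\<pi> = \<rho> @ replicate o3 a3" "sorted_wrt may_precede \<rho>" "\<forall>x\<in>set \<rho>. a3 < x"
    using split_off_least[OF sorted, of a3] by blast
  have o3: "o3 \<le> 1"
    using sorted unfolding \<rho>(1) sorted_wrt_may_precede_append_replicate by (simp add: a3_def)
  have "a4 \<le> x" if "x \<in> set \<rho>" for x
    using \<rho>(3) that unfolding defs by (cases x) (auto simp: less_eq_prod_def less_prod_def)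
  then obtain \<sigma> f4 where \<sigma>: "\<rho> = \<sigma> @ replicate f4 a4" "\<forall>x\<in>set \<sigma>. a4 < x"
    using split_off_least[OF \<rho>(2), of a4] by blast
  define \<tau> where "\<tau> = replicate v b2 @ replicate f b1 @ replicate u b0"
  have \<pi>_eq: "\<pi> = \<sigma> @ replicate f4 a4 @ replicate o3 a3"
    unfolding \<rho>(1) \<sigma>(1) by simp
  have \<tau>: "tail j (u, f, v) = \<tau>"
    by (simp add: tail_def \<tau>_def defs)
  have order: "b0 < b1" "b1 < b2" "b2 < a3" "a3 < a4"
    by (simp_all add: defs less_prod_def)
  have low: "filter (window a) \<sigma> = []" "V_bar (\<sigma> @ \<xi>) a = V_bar \<xi> a" if "a \<le> a4" for a \<xi>
  proof -
    have "\<not> y \<le> a" if "y \<in> set \<sigma>" for y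
      using \<sigma>(2) that \<open>a \<le> a4\<close> by (meson leD order_trans)
    then show "filter (window a) \<sigma> = []" "V_bar (\<sigma> @ \<xi>) a = V_bar \<xi> a"
      by (auto simp: filter_empty_conv window_def V_bar_def)
  qed
  have leq: "b0 \<le> a4" "b1 \<le> a4" "b2 \<le> a4" "a3 \<le> a4" "a4 \<le> a4"
    using order by auto
  have high: "filter (window x) \<tau> = []" "V_bar (\<xi> @ \<tau>) x = V_bar \<xi> x + v + u" if "x \<in> set \<sigma>" for x \<xi>
  proof -
    have x: "a4 < x" using \<sigma>(2) that by blast
    have "\<not> window x b2 \<and> \<not> window x b1 \<and> \<not> window x b0"
      using x by (cases x) (auto simp: defs window_def plus_two_def less_prod_def less_eq_prod_def)
    then show "filter (window x) \<tau> = []" by (simp add: \<tau>_def filter_replicate)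
    have "b2 \<le> x" "b1 \<le> x" "b0 \<le> x" using x order by auto
    then show "V_bar (\<xi> @ \<tau>) x = V_bar \<xi> x + v + u"
      by (simp add: V_bar_def \<tau>_def filter_replicate) (simp add: defs)
  qed
  have sig: "window_ok k c (\<pi> @ \<tau>) x \<longleftrightarrow> window_ok k (c + u + v) \<pi> x" if "x \<in> set \<sigma>" for x
    using high[OF that] by (simp add: window_ok_def add_ac)
  have w4: "window_ok k c (\<pi> @ \<tau>) a4 \<longleftrightarrow> f4 + o3 + v + f \<le> k - 1 \<and> (f4 + o3 + v + f = k - 1 \<longrightarrow>
            [f4 * (j + 2) + (o3 + v + f) * (j + 1) = c + (o3 + v + u)] (mod 2))"
  proof -
    have F: "filter (window a4) (\<pi> @ \<tau>) = replicate f4 a4 @ replicate o3 a3 @ replicate v b2 @ replicate f b1"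
      unfolding \<pi>_eq \<tau>_def filter_append low[OF leq(5)] filter_replicate
      by (simp add: defs window_def plus_two_def less_prod_def less_eq_prod_def)
    have V: "V_bar (\<pi> @ \<tau>) a4 = o3 + v + u"
      unfolding \<pi>_eq \<tau>_def append_assoc unfolding low(2)[OF leq(5)]
      unfolding V_bar_def filter_append filter_replicate
      by (simp add: defs less_prod_def less_eq_prod_def)
    have L: "length (filter (window a4) (\<pi> @ \<tau>)) = f4 + o3 + v + f"
      unfolding F by simp
    have H: "(\<Sum>y\<leftarrow>filter (window a4) (\<pi> @ \<tau>). part_size y div 2) = f4 * (j + 2) + (o3 + v + f) * (j + 1)"
      unfolding F by (simp add: sum_list_replicate defs algebra_simps)
    show ?thesis
      unfolding window_ok_def L H V ..
  qed
  have w3: "window_ok k c (\<pi> @ \<tau>) a3 \<longleftrightarrow> o3 + v + f \<le> k - 1 \<and> (o3 + v + f = k - 1 \<longrightarrow>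
            [(o3 + v + f) * (j + 1) = c + (o3 + v + u)] (mod 2))"
  proof -
    have F: "filter (window a3) (\<pi> @ \<tau>) = replicate o3 a3 @ replicate v b2 @ replicate f b1"
      unfolding \<pi>_eq \<tau>_def filter_append low[OF leq(4)] filter_replicate
      by (simp add: defs window_def plus_two_def less_prod_def less_eq_prod_def)
    have V: "V_bar (\<pi> @ \<tau>) a3 = o3 + v + u"
      unfolding \<pi>_eq \<tau>_def append_assoc unfolding low(2)[OF leq(4)]
      unfolding V_bar_def filter_append filter_replicate
      by (simp add: defs less_prod_def less_eq_prod_def)
    have L: "length (filter (window a3) (\<pi> @ \<tau>)) = o3 + v + f"
      unfolding F by simp
    have H: "(\<Sum>y\<leftarrow>filter (window a3) (\<pi> @ \<tau>). part_size y div 2) = (o3 + v + f) * (j + 1)"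
      unfolding F by (simp add: sum_list_replicate defs algebra_simps)
    show ?thesis
      unfolding window_ok_def L H V ..
  qed
  have w2: "window_ok k c (\<pi> @ \<tau>) b2 \<longleftrightarrow> v + f + u \<le> k - 1 \<and> (v + f + u = k - 1 \<longrightarrow>
            [(v + f) * (j + 1) + u * j = c + (v + u)] (mod 2))"
  proof -
    have F: "filter (window b2) (\<pi> @ \<tau>) = replicate v b2 @ replicate f b1 @ replicate u b0"
      unfolding \<pi>_eq \<tau>_def filter_append low[OF leq(3)] filter_replicate
      by (simp add: defs window_def plus_two_def less_prod_def less_eq_prod_def)
    have V: "V_bar (\<pi> @ \<tau>) b2 = v + u"
      unfolding \<pi>_eq \<tau>_def append_assoc unfolding low(2)[OF leq(3)]
      unfolding V_bar_def filter_append filter_replicate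
      by (simp add: defs less_prod_def less_eq_prod_def)
    have L: "length (filter (window b2) (\<pi> @ \<tau>)) = v + f + u"
      unfolding F by simp
    have H: "(\<Sum>y\<leftarrow>filter (window b2) (\<pi> @ \<tau>). part_size y div 2) = (v + f) * (j + 1) + u * j"
      unfolding F by (simp add: sum_list_replicate defs algebra_simps)
    show ?thesis
      unfolding window_ok_def L H V ..
  qed
  have w1: "window_ok k c (\<pi> @ \<tau>) b1 \<longleftrightarrow> f + u \<le> k - 1 \<and> (f + u = k - 1 \<longrightarrow>
            [f * (j + 1) + u * j = c + u] (mod 2))"
  proof -
    have F: "filter (window b1) (\<pi> @ \<tau>) = replicate f b1 @ replicate u b0"
      unfolding \<pi>_eq \<tau>_def filter_append low[OF leq(2)] filter_replicate
      by (simp add: defs window_def plus_two_def less_prod_def less_eq_prod_def)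
    have V: "V_bar (\<pi> @ \<tau>) b1 = u"
      unfolding \<pi>_eq \<tau>_def append_assoc unfolding low(2)[OF leq(2)]
      unfolding V_bar_def filter_append filter_replicate
      by (simp add: defs less_prod_def less_eq_prod_def)
    have L: "length (filter (window b1) (\<pi> @ \<tau>)) = f + u"
      unfolding F by simp
    have H: "(\<Sum>y\<leftarrow>filter (window b1) (\<pi> @ \<tau>). part_size y div 2) = f * (j + 1) + u * j"
      unfolding F by (simp add: sum_list_replicate defs algebra_simps)
    show ?thesis
      unfolding window_ok_def L H V ..
  qed
  have w0: "window_ok k c (\<pi> @ \<tau>) b0"
  proof -
    have F: "filter (window b0) (\<pi> @ \<tau>) = replicate u b0"
      unfolding \<pi>_eq \<tau>_def filter_append low[OF leq(1)] filter_replicate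
      by (simp add: defs window_def plus_two_def less_prod_def less_eq_prod_def)
    have "u < k - 1" using uv(1) k by linarith
    then show ?thesis
      unfolding window_ok_def F by simp
  qed
  have w4': "window_ok k (c + u + v) \<pi> a4 \<longleftrightarrow> f4 + o3 \<le> k - 1 \<and> (f4 + o3 = k - 1 \<longrightarrow>
         [f4 * (j + 2) + o3 * (j + 1) = c + u + v + o3] (mod 2))"
  proof -
    have F: "filter (window a4) \<pi> = replicate f4 a4 @ replicate o3 a3"
      unfolding \<pi>_eq filter_append low[OF leq(5)] filter_replicate
      by (simp add: defs window_def plus_two_def less_prod_def less_eq_prod_def)
    have V: "V_bar \<pi> a4 = o3"
      unfolding \<pi>_eq append_assoc unfolding low(2)[OF leq(5)]
      unfolding V_bar_def filter_append filter_replicate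
      by (simp add: defs less_prod_def less_eq_prod_def)
    have L: "length (filter (window a4) \<pi>) = f4 + o3"
      unfolding F by simp
    have H: "(\<Sum>y\<leftarrow>filter (window a4) \<pi>. part_size y div 2) = f4 * (j + 2) + o3 * (j + 1)"
      unfolding F by (simp add: sum_list_replicate defs algebra_simps)
    show ?thesis
      unfolding window_ok_def L H V ..
  qed
  have w3': "window_ok k (c + u + v) \<pi> a3"
  proof -
    have F: "filter (window a3) \<pi> = replicate o3 a3"
      unfolding \<pi>_eq filter_append low[OF leq(4)] filter_replicate
      by (simp add: defs window_def plus_two_def less_prod_def less_eq_prod_def)
    have "o3 < k - 1" using o3 k by linarith
    then show ?thesis
      unfolding window_ok_def F by simp
  qed
  have m: "length (filter (\<lambda>x. x \<le> (2 * (j + 1) + 2, False)) \<pi>) = f4 + o3"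
  proof -
    have a4: "(2 * (j + 1) + 2, False) = a4" by (simp add: a4_def)
    have "filter (\<lambda>x. x \<le> a4) \<sigma> = []"
      using \<sigma>(2) by (auto simp: filter_empty_conv leD)
    then show ?thesis
      unfolding a4 \<pi>_eq using leq by (simp add: filter_replicate)
  qed
  have W1: "windows_ok k c (\<pi> @ \<tau>) \<longleftrightarrow> (\<forall>x\<in>set \<sigma>. window_ok k (c + u + v) \<pi> x) \<and>
     (f4 > 0 \<longrightarrow> window_ok k c (\<pi> @ \<tau>) a4) \<and> (o3 > 0 \<longrightarrow> window_ok k c (\<pi> @ \<tau>) a3) \<and>
     (v > 0 \<longrightarrow> window_ok k c (\<pi> @ \<tau>) b2) \<and> (f > 0 \<longrightarrow> window_ok k c (\<pi> @ \<tau>) b1)"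
  proof -
    have "set (\<pi> @ \<tau>) = set \<sigma> \<union> set (replicate f4 a4) \<union> set (replicate o3 a3) \<union>
       set (replicate v b2) \<union> set (replicate f b1) \<union> set (replicate u b0)"
      by (simp add: \<pi>_eq \<tau>_def Un_assoc)
    then show ?thesis
      unfolding windows_ok_iff using sig w0
      by (simp only: ball_Un) (simp add: set_replicate_conv_if del: set_append)
  qed
  have W2: "windows_ok k (c + u + v) \<pi> \<longleftrightarrow> (\<forall>x\<in>set \<sigma>. window_ok k (c + u + v) \<pi> x) \<and>
     (f4 > 0 \<longrightarrow> window_ok k (c + u + v) \<pi> a4)"
  proof -
    have "set \<pi> = set \<sigma> \<union> set (replicate f4 a4) \<union> set (replicate o3 a3)"
      by (simp add: \<pi>_eq Un_assoc)
    then show ?thesis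
      unfolding windows_ok_iff using w3'
      by (simp only: ball_Un) (simp add: set_replicate_conv_if)
  qed
  show ?thesis
    unfolding \<tau> m W1 W2 w4 w3 w2 w1 w4' windows_ok_append_tail_aux[OF k uv o3] \<delta>_def[symmetric]
    by (simp only: conj_ac)
qed

lemma append_tail_in_level_set_iff:
  fixes k j c s u f v :: nat
  assumes k: "k > 2" and \<pi>: "\<And>x. x \<in> set \<pi> \<Longrightarrow> 2 * j + 2 < part_size x"
  defines "\<delta> \<equiv> \<lambda>t. parity_defect k j c t"
  shows "\<pi> @ tail j (u, f, v) \<in> level_set k j s c \<longleftrightarrow>
    u \<le> 1 \<and> v \<le> 1 \<and> u + f \<le> s \<and> u + f + v + \<delta> (u + f) \<le> k - 1 \<and>
    \<pi> \<in> level_set k (j + 1) (k - 1 - \<delta> (u + f) - f - v) (c + u + v)"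
proof -
  have "\<not> x \<le> (2 * j + 2, False)" if "x \<in> set \<pi>" for x
    using \<pi>[OF that] by (cases x) (simp add: less_eq_prod_def)
  then have "filter (\<lambda>x. x \<le> (2 * j + 2, False)) \<pi> = []"
    by (simp add: filter_empty_conv)
  then have len: "length (filter (\<lambda>x. x \<le> (2 * j + 2, False)) (\<pi> @ tail j (u, f, v))) = u + f"
    by (simp add: tail_def filter_replicate less_eq_prod_def)
  define S where "S \<longleftrightarrow> sorted_wrt may_precede \<pi>"
  define Q where "Q \<longleftrightarrow> (\<forall>x\<in>set \<pi>. 2 * (j + 1) < part_size x \<and> (\<not> overlined x \<longrightarrow> even (part_size x)))"
  have "\<forall>x\<in>set (tail j (u, f, v)). 2 * j < part_size x \<and> (\<not> overlined x \<longrightarrow> even (part_size x))"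
    by (auto simp: tail_def)
  moreover have "2 * j < part_size x \<and> 2 * (j + 1) < part_size x" if "x \<in> set \<pi>" for x
    using \<pi>[OF that] by simp
  ultimately have Q: "(\<forall>x\<in>set (\<pi> @ tail j (u, f, v)). 2 * j < part_size x \<and> (\<not> overlined x \<longrightarrow> even (part_size x))) \<longleftrightarrow> Q"
    unfolding set_append ball_Un Q_def by blast
  have w: "windows_ok k c (\<pi> @ tail j (u, f, v)) \<longleftrightarrow> u + f + v + \<delta> (u + f) \<le> k - 1 \<and>
    length (filter (\<lambda>x. x \<le> (2 * (j + 1) + 2, False)) \<pi>) \<le> k - 1 - \<delta> (u + f) - f - v \<and>
    windows_ok k (c + u + v) \<pi>" if "u \<le> 1" "v \<le> 1" S Q
    unfolding \<delta>_def using that unfolding S_def Q_def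
    by (intro windows_ok_append_tail[OF k]) simp_all
  have sorted: "sorted_wrt may_precede (\<pi> @ tail j (u, f, v)) \<longleftrightarrow> S \<and> u \<le> 1 \<and> v \<le> 1"
    unfolding S_def by (rule sorted_append_tail) (rule \<pi>)
  show ?thesis
    unfolding level_set_def mem_Collect_eq sorted Q len S_def[symmetric] Q_def[symmetric]
    using w by blast
qed

subsection \<open>Formal power series modulo powers of the variable\<close>

text \<open>Congruence modulo the ideal generated by \<open>fps_X ^ M\<close>. It is compatible with
  the ring operations, and congruence for every \<open>M\<close> is equality, so it replaces
  convergence.\<close>

definition agree :: "nat \<Rightarrow> 'a::comm_ring_1 fps \<Rightarrow> 'a fps \<Rightarrow> bool" where
  "agree M f g \<longleftrightarrow> (\<forall>i<M. f $ i = g $ i)"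

lemma agree_refl [simp]: "agree M f f"
  by (simp add: agree_def)

lemma agree_sym: "agree M f g \<Longrightarrow> agree M g f"
  by (simp add: agree_def)

lemma agree_trans [trans]: "agree M f g \<Longrightarrow> agree M g h \<Longrightarrow> agree M f h"
  by (simp add: agree_def)

lemma agree_mono: "agree M f g \<Longrightarrow> N \<le> M \<Longrightarrow> agree N f g"
  by (simp add: agree_def)

lemma agree_nth: "agree M f g \<Longrightarrow> i < M \<Longrightarrow> f $ i = g $ i"
  by (simp add: agree_def)

lemma agree_imp_eq: "(\<And>M. agree M f g) \<Longrightarrow> f = g"
  by (rule fps_ext) (meson agree_nth lessI)

lemma agree_add: "agree M f g \<Longrightarrow> agree M f' g' \<Longrightarrow> agree M (f + f') (g + g')"
  by (simp add: agree_def)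

lemma agree_diff: "agree M f g \<Longrightarrow> agree M f' g' \<Longrightarrow> agree M (f - f') (g - g')"
  by (simp add: agree_def)

lemma agree_mult: "agree M f g \<Longrightarrow> agree M f' g' \<Longrightarrow> agree M (f * f') (g * g')"
  unfolding agree_def fps_mult_nth by (auto intro!: sum.cong)

lemma agree_sum: "(\<And>i. i \<in> A \<Longrightarrow> agree M (f i) (g i)) \<Longrightarrow> agree M (sum f A) (sum g A)"
  by (induction A rule: infinite_finite_induct) (auto intro: agree_add)

lemma agree_prod: "(\<And>i. i \<in> A \<Longrightarrow> agree M (f i) (g i)) \<Longrightarrow> agree M (prod f A) (prod g A)"
  by (induction A rule: infinite_finite_induct) (auto intro: agree_mult)

lemma agree_prod_1: "(\<And>i. i \<in> A \<Longrightarrow> agree M (f i) 1) \<Longrightarrow> agree M (prod f A) 1"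
  using agree_prod[of A M f "\<lambda>_. 1"] by simp

lemma agree_sum_0: "(\<And>i. i \<in> A \<Longrightarrow> agree M (f i) 0) \<Longrightarrow> agree M (sum f A) 0"
  using agree_sum[of A M f "\<lambda>_. 0"] by simp

lemma agree_mult_0: "agree M f 0 \<Longrightarrow> agree M (f * g) 0" "agree M f 0 \<Longrightarrow> agree M (g * f) 0"
  using agree_mult[of M f 0 g g] agree_mult[of M g g f 0] by auto

lemma agree_mult_1: "agree M f 1 \<Longrightarrow> agree M g 1 \<Longrightarrow> agree M (f * g) 1"
  using agree_mult[of M f 1 g 1] by auto

lemma agree_X_power_mult:
  assumes "agree M f g" "N \<le> M + e" shows "agree N (fps_X ^ e * f) (fps_X ^ e * g)"
  using assms by (auto simp: agree_def fps_X_power_mult_nth)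

lemma agree_X_power_0: "M \<le> e \<Longrightarrow> agree M (fps_X ^ e) 0"
  by (simp add: agree_def fps_X_power_nth)

lemma agree_inverse:
  fixes f g :: "'a::field fps"
  assumes "agree M f g" "f $ 0 \<noteq> 0"
  shows "agree M (inverse f) (inverse g)"
proof (cases M)
  case (Suc M')
  then have "g $ 0 \<noteq> 0"
    using assms by (metis agree_nth zero_less_Suc)
  then have g: "g * inverse g = 1"
    by (rule inverse_mult_eq_1')
  have f: "inverse f * f = 1"
    using assms(2) by (rule inverse_mult_eq_1)
  have "agree M (inverse f * f * inverse g) (inverse f * g * inverse g)"
    by (intro agree_mult assms agree_refl)
  then show ?thesis
    using f g by (metis agree_sym mult.assoc mult.right_neutral mult_1)
qed (simp add: agree_def)

lemma agree_add_X_power: "M \<le> e \<Longrightarrow> agree M (1 + fps_X ^ e) 1"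
  using agree_add[OF agree_refl agree_X_power_0, of M e 1] by simp

lemma agree_diff_X_power: "M \<le> e \<Longrightarrow> agree M (1 - fps_X ^ e) 1"
  using agree_diff[OF agree_refl agree_X_power_0, of M e 1] by simp

lemma one_minus_X_power_nth_0: "e > 0 \<Longrightarrow> (1 - fps_X ^ e :: 'a::comm_ring_1 fps) $ 0 = 1"
  by simp

lemma one_minus_X_power_inverse:
  "e > 0 \<Longrightarrow> (1 - fps_X ^ e) * inverse (1 - fps_X ^ e :: 'a::field fps) = 1"
  by (rule inverse_mult_eq_1') simp

lemma one_minus_X_power_nonzero: "e > 0 \<Longrightarrow> (1 - fps_X ^ e :: 'a::field fps) \<noteq> 0"
  by (metis one_minus_X_power_nth_0 fps_zero_nth zero_neq_one)

lemma agree_inverse_diff_X_power: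
  "0 < e \<Longrightarrow> M \<le> e \<Longrightarrow> agree M (inverse (1 - fps_X ^ e :: 'a::field fps)) 1"
  using agree_inverse[OF agree_diff_X_power, of M e] by simp

text \<open>Coefficient \<open>n\<close> reads only the terms up to index \<open>n\<close>; this is
  the infinite sum whenever term \<open>m\<close> is divisible by \<open>fps_X ^ m\<close>.\<close>

definition fps_series :: "(nat \<Rightarrow> 'a::comm_ring_1 fps) \<Rightarrow> 'a fps" where
  "fps_series f = Abs_fps (\<lambda>n. \<Sum>m\<le>n. f m $ n)"

lemma fps_series_agree:
  assumes "\<And>m. agree m (f m) 0" "M \<le> Suc N"
  shows "agree M (fps_series f) (\<Sum>m\<le>N. f m)"
  unfolding agree_def
proof (intro allI impI)
  fix n assume "n < M"
  then have "n \<le> N" using assms(2) by simp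
  have "(\<Sum>m\<le>N. f m $ n) = (\<Sum>m\<le>n. f m $ n)"
    using \<open>n \<le> N\<close> assms(1) by (intro sum.mono_neutral_right) (auto simp: agree_def)
  then show "fps_series f $ n = (\<Sum>m\<le>N. f m) $ n"
    by (simp add: fps_series_def fps_sum_nth)
qed

lemma fps_series_add: "fps_series f + fps_series g = fps_series (\<lambda>n. f n + g n)"
  by (rule fps_ext) (simp add: fps_series_def sum.distrib)

lemma fps_series_diff: "fps_series f - fps_series g = fps_series (\<lambda>n. f n - g n)"
  by (rule fps_ext) (simp add: fps_series_def sum_subtractf)

lemma fps_series_mult:
  assumes "\<And>m. agree m (f m) 0"
  shows "c * fps_series f = fps_series (\<lambda>n. c * f n)"
proof (rule agree_imp_eq)
  fix M
  have "agree M (c * fps_series f) (c * (\<Sum>m\<le>M. f m))"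
    by (intro agree_mult fps_series_agree agree_refl assms) simp
  also have "c * (\<Sum>m\<le>M. f m) = (\<Sum>m\<le>M. c * f m)"
    by (rule sum_distrib_left)
  also have "agree M (\<Sum>m\<le>M. c * f m) (fps_series (\<lambda>n. c * f n))"
    by (rule agree_sym, rule fps_series_agree) (auto intro: agree_mult_0 assms)
  finally show "agree M (c * fps_series f) (fps_series (\<lambda>n. c * f n))" .
qed

lemma fps_series_Suc:
  assumes "\<And>m. agree m (f m) 0"
  shows "fps_series f = f 0 + fps_series (\<lambda>n. f (Suc n))"
proof (rule agree_imp_eq)
  fix M
  have "agree M (fps_series f) (\<Sum>m\<le>Suc M. f m)"
    by (intro fps_series_agree assms) simp
  also have "(\<Sum>m\<le>Suc M. f m) = f 0 + (\<Sum>m\<le>M. f (Suc m))"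
    by (rule sum.atMost_Suc_shift)
  also have "agree M \<dots> (f 0 + fps_series (\<lambda>n. f (Suc n)))"
    by (rule agree_add[OF agree_refl agree_sym], rule fps_series_agree)
      (auto intro: agree_mono assms)
  finally show "agree M (fps_series f) (f 0 + fps_series (\<lambda>n. f (Suc n)))" .
qed

text \<open>Factor \<open>i\<close> is meant to be 1 modulo \<open>fps_X ^ Suc i\<close>, so the
  factors with index below \<open>n\<close> already determine coefficient \<open>n\<close>.\<close>

definition fps_iprod :: "(nat \<Rightarrow> 'a::comm_ring_1 fps) \<Rightarrow> 'a fps" where
  "fps_iprod f = Abs_fps (\<lambda>n. (\<Prod>i<n. f i) $ n)"

lemma fps_iprod_agree:
  assumes f: "\<And>i. agree (Suc i) (f i) 1" and "M \<le> Suc N"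
  shows "agree M (fps_iprod f) (\<Prod>i<N. f i)"
  unfolding agree_def
proof (intro allI impI)
  fix n assume "n < M"
  then have "n \<le> N" using assms(2) by simp
  then have "{..<N} = {..<n} \<union> {n..<N}" by auto
  then have "(\<Prod>i<N. f i) = (\<Prod>i<n. f i) * (\<Prod>i\<in>{n..<N}. f i)"
    by (simp add: prod.union_disjoint ivl_disj_int)
  moreover have "agree (Suc n) ((\<Prod>i<n. f i) * (\<Prod>i\<in>{n..<N}. f i)) ((\<Prod>i<n. f i) * 1)"
    by (intro agree_mult agree_refl agree_prod_1) (auto intro: agree_mono[OF f])
  ultimately show "fps_iprod f $ n = (\<Prod>i<N. f i) $ n"
    by (simp add: fps_iprod_def agree_def)
qed

lemma fps_iprod_Suc:
  assumes f: "\<And>i. agree (Suc i) (f i) 1"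
  shows "fps_iprod f = f 0 * fps_iprod (\<lambda>i. f (Suc i))"
proof (rule agree_imp_eq)
  fix M
  have "agree M (fps_iprod f) (\<Prod>i<Suc M. f i)"
    by (intro fps_iprod_agree assms) simp
  also have "(\<Prod>i<Suc M. f i) = f 0 * (\<Prod>i<M. f (Suc i))"
    by (rule prod.lessThan_Suc_shift)
  also have "agree M \<dots> (f 0 * fps_iprod (\<lambda>i. f (Suc i)))"
    by (rule agree_mult[OF agree_refl agree_sym], rule fps_iprod_agree)
      (auto intro: agree_mono[OF f])
  finally show "agree M (fps_iprod f) (f 0 * fps_iprod (\<lambda>i. f (Suc i)))" .
qed

lemma fps_iprod_agree_1:
  assumes "\<And>i. agree (Suc i) (f i) 1" "\<And>i. agree M (f i) 1"
  shows "agree M (fps_iprod f) 1"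
  by (rule agree_trans[OF fps_iprod_agree[of f M M] agree_prod_1]) (auto intro: assms)

section \<open>Infinite products and the functional equations of Andrews' functions\<close>

abbreviation q :: "rat fps" where "q \<equiv> fps_X"

definition even_prod :: "nat \<Rightarrow> rat fps" where
  "even_prod j = fps_iprod (\<lambda>i. 1 + q ^ (2 * (j + i + 1)))"

definition ratio_prod :: "nat \<Rightarrow> rat fps" where
  "ratio_prod l = fps_iprod (\<lambda>i. (1 + q ^ (2 * (l + i) + 1)) * inverse (1 - q ^ (2 * (l + i))))"

lemma even_prod_Suc: "even_prod j = (1 + q ^ (2 * (j + 1))) * even_prod (Suc j)"
  unfolding even_prod_def by (subst fps_iprod_Suc, rule agree_add_X_power) simp_all

lemma even_prod_agree_1: "agree j (even_prod j) 1"
  unfolding even_prod_def by (rule fps_iprod_agree_1; rule agree_add_X_power) simp_all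

lemma ratio_prod_factor_agree:
  "l \<ge> 1 \<Longrightarrow> M \<le> 2 * (l + i) \<Longrightarrow>
   agree M ((1 + q ^ (2 * (l + i) + 1)) * inverse (1 - q ^ (2 * (l + i)))) 1"
  by (intro agree_mult_1 agree_add_X_power agree_inverse_diff_X_power) auto

lemma ratio_prod_Suc:
  assumes "l \<ge> 1"
  shows "(1 - q ^ (2 * l)) * ratio_prod l = (1 + q ^ (2 * l + 1)) * ratio_prod (Suc l)"
proof -
  have "ratio_prod l = (1 + q ^ (2 * l + 1)) * inverse (1 - q ^ (2 * l)) * ratio_prod (Suc l)"
    unfolding ratio_prod_def by (subst fps_iprod_Suc) (use assms ratio_prod_factor_agree[of l] in auto)
  then have "(1 - q ^ (2 * l)) * ratio_prod l =
    ((1 - q ^ (2 * l)) * inverse (1 - q ^ (2 * l))) * ((1 + q ^ (2 * l + 1)) * ratio_prod (Suc l))"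
    by (simp add: mult_ac)
  then show ?thesis
    using assms by (simp add: one_minus_X_power_inverse)
qed

lemma ratio_prod_agree_1: "l \<ge> 1 \<Longrightarrow> agree l (ratio_prod l) 1"
  unfolding ratio_prod_def by (rule fps_iprod_agree_1; rule ratio_prod_factor_agree) auto

text \<open>With Q = \<open>q^2\<close>, this is \<open>(-q; Q)_n / (Q; Q)_n\<close> times the
  quotient of \<open>(-q^(2 (m + n) + 1); Q)\<close> by \<open>(q^(2 (m + n)); Q)\<close>, both
  infinite: the part of Andrews' summand that depends on his parameter \<open>a\<close>.\<close>

definition weight_prod :: "nat \<Rightarrow> nat \<Rightarrow> rat fps" where
  "weight_prod m n = (\<Prod>i<n. (1 + q ^ (2 * i + 1)) * inverse (1 - q ^ (2 * (i + 1)))) * ratio_prod (m + n)"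

text \<open>Together with \<open>weight_prod_shift_index\<close> this provides two routes to the
  same \<open>weight_prod (Suc m) n\<close>, one cancelling the first denominator of the infinite
  tail, the other the last denominator of the finite product. The common target lets the terms of
  two series be merged.\<close>

lemma weight_prod_shift_level:
  assumes "m \<ge> 1"
  shows "(1 - q ^ (2 * (m + n))) * weight_prod m n = (1 + q ^ (2 * (m + n) + 1)) * weight_prod (Suc m) n"
proof -
  define V where "V = (\<Prod>i<n. (1 + q ^ (2 * i + 1)) * inverse (1 - q ^ (2 * (i + 1))))"
  have "(1 - q ^ (2 * (m + n))) * weight_prod m n = V * ((1 - q ^ (2 * (m + n))) * ratio_prod (m + n))"
    by (simp add: weight_prod_def V_def mult_ac)
  also have "\<dots> = V * ((1 + q ^ (2 * (m + n) + 1)) * ratio_prod (Suc (m + n)))"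
    using ratio_prod_Suc[of "m + n"] assms by simp
  also have "\<dots> = (1 + q ^ (2 * (m + n) + 1)) * weight_prod (Suc m) n"
    by (simp add: weight_prod_def V_def mult_ac)
  finally show ?thesis .
qed

lemma weight_prod_shift_index:
  "(1 - q ^ (2 * (n + 1))) * weight_prod m (Suc n) = (1 + q ^ (2 * n + 1)) * weight_prod (Suc m) n"
proof -
  have "(1 - q ^ (2 * (n + 1))) * weight_prod m (Suc n) =
    ((1 - q ^ (2 * (n + 1))) * inverse (1 - q ^ (2 * (n + 1)))) * ((1 + q ^ (2 * n + 1)) * weight_prod (Suc m) n)"
    by (simp add: weight_prod_def mult_ac)
  then show ?thesis
    using one_minus_X_power_inverse[of "2 * (n + 1)", where 'a = rat] by (simp only:)  simp
qed

text \<open>For \<open>m = 1\<close> the finite and infinite denominators join to one full product,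
  and the joined numerators miss just the factor \<open>1 + q ^ (2 * n + 1)\<close>. Hence the
  weights can be taken out of a series as soon as its terms contain this factor.\<close>

lemma weight_prod_1: "(1 + q ^ (2 * n + 1)) * weight_prod 1 n = (1 + q) * ratio_prod 1"
proof (induction n)
  case (Suc n)
  have "(1 - q ^ (2 * (n + 1))) * ((1 + q ^ (2 * Suc n + 1)) * weight_prod 1 (Suc n)) =
        (1 + q ^ (2 * Suc n + 1)) * ((1 - q ^ (2 * (n + 1))) * weight_prod 1 (Suc n))"
    by (rule mult.left_commute)
  also have "\<dots> = (1 + q ^ (2 * n + 1)) * ((1 + q ^ (2 * Suc n + 1)) * weight_prod 2 n)"
    by (subst weight_prod_shift_index) (simp only: mult.left_commute Suc_1)
  also have "(1 + q ^ (2 * Suc n + 1)) * weight_prod 2 n = (1 - q ^ (2 * (n + 1))) * weight_prod 1 n"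
    using weight_prod_shift_level[of 1 n] by (simp add: numeral_2_eq_2)
  also have "(1 + q ^ (2 * n + 1)) * \<dots> = (1 - q ^ (2 * (n + 1))) * ((1 + q) * ratio_prod 1)"
    by (subst Suc[symmetric]) (rule mult.left_commute)
  finally have "(1 - q ^ (2 * (n + 1))) * ((1 + q ^ (2 * Suc n + 1)) * weight_prod 1 (Suc n)) =
    (1 - q ^ (2 * (n + 1))) * ((1 + q) * ratio_prod 1)" .
  then show ?case
    using one_minus_X_power_nonzero[of "2 * (n + 1)"] by (subst (asm) mult_left_cancel) auto
qed (simp add: weight_prod_def)

text \<open>
  With \<open>K = d + i\<close>, \<open>Q = q^2\<close>, \<open>x = Q^j\<close> and \<open>a = - 1 / q\<close>, the series \<open>hfun d i j\<close> is Andrews'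
  \<open>H_(K,i) (a; x Q; Q)\<close>, and \<open>gollnitz (K - 1) s j\<close> below is his \<open>J_(K,s+1) (a; x; Q)\<close>.  The arguments
  \<open>d\<close> and \<open>i\<close> make all exponents visibly non-negative.
\<close>
definition hterm :: "nat \<Rightarrow> nat \<Rightarrow> nat \<Rightarrow> nat \<Rightarrow> rat fps" where
  "hterm d i j n = (-1) ^ n * (q ^ (n * (2 * i * (j + n) + 2 * d * (j + n + 1) + 1)) *
     (1 - q ^ (2 * i * (j + 1 + 2 * n))) * weight_prod (j + 1) n)"

lemma hterm_agree_0: "agree n (hterm d i j n) 0"
  unfolding hterm_def by (intro agree_mult_0 agree_X_power_0) simp

definition hfun :: "nat \<Rightarrow> nat \<Rightarrow> nat \<Rightarrow> rat fps" where
  "hfun d i j = fps_series (hterm d i j)"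

lemma hfun_0: "hfun d 0 j = 0"
  by (rule fps_ext) (simp add: hfun_def fps_series_def hterm_def)

text \<open>
  The difference of two terms splits into a part that cancels the denominator of \<open>weight_prod\<close> at index
  \<open>n\<close> and a part that cancels its level; after shifting the index of the former both match.
\<close>
lemma hterm_recurrence:
  fixes d i j n :: nat
  defines "a \<equiv> \<lambda>n. (-1) ^ n * (q ^ (n * (2 * Suc i * (j + n) + 2 * d * (j + n + 1) + 1)) *
       (1 - q ^ (2 * n)) * weight_prod (j + 1) n)"
    and "b \<equiv> \<lambda>n. (-1) ^ n * (q ^ (n * (2 * Suc i * (j + n) + 2 * d * (j + n + 1) + 1) +
        2 * i * (j + 1 + 2 * n) + 2 * n) * (1 - q ^ (2 * (j + 1 + n))) * weight_prod (j + 1) n)"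
  shows "hterm d (Suc i) j n - hterm (Suc d) i j n = a n + b n"
    and "a (Suc n) + b n = q ^ (2 * (j + 1) * i) *
     (hterm i (Suc d) (Suc j) n + q ^ (2 * (j + 1) + 1) * hterm (Suc i) d (Suc j) n)"
proof -
  have "q ^ (n * (2 * Suc i * (j + n) + 2 * d * (j + n + 1) + 1)) * (1 - q ^ (2 * Suc i * (j + 1 + 2 * n)))
    - q ^ (n * (2 * i * (j + n) + 2 * Suc d * (j + n + 1) + 1)) * (1 - q ^ (2 * i * (j + 1 + 2 * n)))
   = q ^ (n * (2 * Suc i * (j + n) + 2 * d * (j + n + 1) + 1)) * (1 - q ^ (2 * n)) +
     q ^ (n * (2 * Suc i * (j + n) + 2 * d * (j + n + 1) + 1) +
        2 * i * (j + 1 + 2 * n) + 2 * n) * (1 - q ^ (2 * (j + 1 + n)))"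
    unfolding right_diff_distrib power_add[symmetric] mult_1_right
    by (simp add: algebra_simps)
  then show "hterm d (Suc i) j n - hterm (Suc d) i j n = a n + b n"
    unfolding hterm_def a_def b_def
    by (metis (no_types, opaque_lifting) left_diff_distrib right_diff_distrib distrib_left distrib_right)
next
  define w where "w = weight_prod (Suc (j + 1)) n"
  have a: "a (Suc n) = (-1) ^ n * ((- (q ^ (Suc n * (2 * Suc i * (j + Suc n) + 2 * d * (j + Suc n + 1) + 1)) * (1 + q ^ (2 * n + 1)))) * w)"
    using weight_prod_shift_index[of n "j + 1"] by (simp add: a_def w_def mult.assoc)
  have b: "b n = (-1) ^ n * ((q ^ (n * (2 * Suc i * (j + n) + 2 * d * (j + n + 1) + 1) +
        2 * i * (j + 1 + 2 * n) + 2 * n) * (1 + q ^ (2 * (j + 1 + n) + 1))) * w)"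
    using weight_prod_shift_level[of "j + 1" n] by (simp add: b_def w_def mult.assoc)
  have r: "q ^ (2 * (j + 1) * i) *
     (hterm i (Suc d) (Suc j) n + q ^ (2 * (j + 1) + 1) * hterm (Suc i) d (Suc j) n) =
     (-1) ^ n * ((q ^ (2 * (j + 1) * i) * (q ^ (n * (2 * Suc d * (Suc j + n) + 2 * i * (Suc j + n + 1) + 1)) *
     (1 - q ^ (2 * Suc d * (Suc j + 1 + 2 * n))) +
     q ^ (2 * (j + 1) + 1) * (q ^ (n * (2 * d * (Suc j + n) + 2 * Suc i * (Suc j + n + 1) + 1)) *
     (1 - q ^ (2 * d * (Suc j + 1 + 2 * n)))))) * w)"
    by (simp add: hterm_def w_def algebra_simps)
  have "- (q ^ (Suc n * (2 * Suc i * (j + Suc n) + 2 * d * (j + Suc n + 1) + 1)) * (1 + q ^ (2 * n + 1))) +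
    q ^ (n * (2 * Suc i * (j + n) + 2 * d * (j + n + 1) + 1) +
        2 * i * (j + 1 + 2 * n) + 2 * n) * (1 + q ^ (2 * (j + 1 + n) + 1)) =
    q ^ (2 * (j + 1) * i) * (q ^ (n * (2 * Suc d * (Suc j + n) + 2 * i * (Suc j + n + 1) + 1)) *
     (1 - q ^ (2 * Suc d * (Suc j + 1 + 2 * n))) +
     q ^ (2 * (j + 1) + 1) * (q ^ (n * (2 * d * (Suc j + n) + 2 * Suc i * (Suc j + n + 1) + 1)) *
     (1 - q ^ (2 * d * (Suc j + 1 + 2 * n)))))"
    unfolding right_diff_distrib distrib_left power_add[symmetric] mult_1_right
    by (simp add: algebra_simps power_add[symmetric])
  then show "a (Suc n) + b n = q ^ (2 * (j + 1) * i) *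
     (hterm i (Suc d) (Suc j) n + q ^ (2 * (j + 1) + 1) * hterm (Suc i) d (Suc j) n)"
    unfolding a b r by (metis (no_types, opaque_lifting) distrib_left distrib_right)
qed

lemma hfun_recurrence:
  "hfun d (Suc i) j - hfun (Suc d) i j = q ^ (2 * (j + 1) * i) *
     (hfun i (Suc d) (Suc j) + q ^ (2 * (j + 1) + 1) * hfun (Suc i) d (Suc j))"
proof -
  define a where "a = (\<lambda>n. (-1) ^ n * (q ^ (n * (2 * Suc i * (j + n) + 2 * d * (j + n + 1) + 1)) *
       (1 - q ^ (2 * n)) * weight_prod (j + 1) n))"
  define b where "b = (\<lambda>n. (-1) ^ n * (q ^ (n * (2 * Suc i * (j + n) + 2 * d * (j + n + 1) + 1) +
        2 * i * (j + 1 + 2 * n) + 2 * n) * (1 - q ^ (2 * (j + 1 + n))) * weight_prod (j + 1) n))"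
  have "agree n (a n) 0" for n
    unfolding a_def by (intro agree_mult_0 agree_X_power_0) simp
  \<comment> \<open>The factor \<open>1 - q ^ (2 * n)\<close> makes \<open>a 0\<close> vanish, so
    shifting the index loses no term.\<close>
  then have "fps_series a = fps_series (\<lambda>n. a (Suc n))"
    using fps_series_Suc[of a] by (simp add: a_def)
  then have "hfun d (Suc i) j - hfun (Suc d) i j = fps_series (\<lambda>n. a (Suc n) + b n)"
    unfolding hfun_def fps_series_diff hterm_recurrence(1) fps_series_add[symmetric]
    by (simp only: a_def b_def)
  also have "\<dots> = fps_series (\<lambda>n. q ^ (2 * (j + 1) * i) *
     (hterm i (Suc d) (Suc j) n + q ^ (2 * (j + 1) + 1) * hterm (Suc i) d (Suc j) n))"
    unfolding a_def b_def hterm_recurrence(2) ..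
  also have "\<dots> = q ^ (2 * (j + 1) * i) *
     (hfun i (Suc d) (Suc j) + q ^ (2 * (j + 1) + 1) * hfun (Suc i) d (Suc j))"
    unfolding hfun_def
    unfolding fps_series_mult[OF hterm_agree_0] fps_series_add
    by (rule fps_series_mult[symmetric])
      (use agree_add[OF hterm_agree_0 agree_mult_0(2)[OF hterm_agree_0]] in simp)
  finally show ?thesis .
qed

definition gollnitz :: "nat \<Rightarrow> nat \<Rightarrow> nat \<Rightarrow> rat fps" where
  "gollnitz L s j = hfun (L - s) (Suc s) j + q ^ (2 * j + 1) * hfun (Suc (L - s)) s j"

lemma hfun_diff_eq_gollnitz:
  "s \<le> L \<Longrightarrow> hfun (L - s) (Suc s) j - hfun (Suc (L - s)) s j = q ^ (2 * (j + 1) * s) * gollnitz L (L - s) (Suc j)"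
  by (subst hfun_recurrence) (simp add: gollnitz_def)

lemma gollnitz_0: "gollnitz L 0 j = gollnitz L L (Suc j)"
  using hfun_diff_eq_gollnitz[of 0 L j] by (simp add: gollnitz_def hfun_0)

text \<open>The four series in the difference regroup into two differences of the form treated in
  \<open>hfun_diff_eq_gollnitz\<close>, at \<open>Suc s\<close> and at \<open>s\<close>, because
  \<open>Suc (L - Suc s) = L - s\<close>.\<close>

lemma gollnitz_Suc:
  assumes "Suc s \<le> L"
  shows "gollnitz L (Suc s) j = gollnitz L s j + q ^ (2 * (j + 1) * Suc s) * gollnitz L (L - Suc s) (Suc j) +
    q ^ (2 * (j + 1) * s + 2 * j + 1) * gollnitz L (L - s) (Suc j)"
proof -
  have d: "Suc (L - Suc s) = L - s" using assms by simp
  have "gollnitz L (Suc s) j - gollnitz L s j = (hfun (L - Suc s) (Suc (Suc s)) j - hfun (Suc (L - Suc s)) (Suc s) j)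
     + q ^ (2 * j + 1) * (hfun (L - s) (Suc s) j - hfun (Suc (L - s)) s j)"
    unfolding gollnitz_def d by (simp add: algebra_simps)
  also have "\<dots> = q ^ (2 * (j + 1) * Suc s) * gollnitz L (L - Suc s) (Suc j) +
     q ^ (2 * j + 1) * (q ^ (2 * (j + 1) * s) * gollnitz L (L - s) (Suc j))"
    using assms by (subst (1 2) hfun_diff_eq_gollnitz) auto
  finally show ?thesis
    by (simp add: algebra_simps power_add)
qed

text \<open>Only the term of index 0 in the first series survives modulo \<open>q ^ j\<close>: every
  other exponent is at least \<open>j\<close>, and the second series carries the factor
  \<open>q ^ (2 * j + 1)\<close>.\<close>

lemma gollnitz_agree_1: "agree j (gollnitz L s j) 1"
proof -
  have "agree j (fps_series (\<lambda>n. hterm (L - s) (Suc s) j (Suc n))) 0"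
  proof (rule agree_trans[OF fps_series_agree[where N = j]])
    fix m show "agree m (hterm (L - s) (Suc s) j (Suc m)) 0"
      by (rule agree_mono[OF hterm_agree_0]) simp
  next
    show "agree j (\<Sum>m\<le>j. hterm (L - s) (Suc s) j (Suc m)) 0"
      unfolding hterm_def by (intro agree_sum_0 agree_mult_0 agree_X_power_0) simp
  qed simp
  moreover have "agree j (hterm (L - s) (Suc s) j 0) 1"
  proof -
    have "agree j ((1 - q ^ (2 * Suc s * (j + 1 + 2 * 0))) * ratio_prod (j + 1)) 1"
      by (intro agree_mult_1 agree_diff_X_power agree_mono[OF ratio_prod_agree_1]) auto
    then show ?thesis
      by (simp add: hterm_def weight_prod_def)
  qed
  ultimately have "agree j (hfun (L - s) (Suc s) j) (1 + 0)"
    unfolding hfun_def by (subst fps_series_Suc[OF hterm_agree_0]) (rule agree_add)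
  moreover have "agree j (q ^ (2 * j + 1) * hfun (Suc (L - s)) s j) 0"
    by (intro agree_mult_0 agree_X_power_0) simp
  ultimately show ?thesis
    unfolding gollnitz_def using agree_add by fastforce
qed

text \<open>A bilateral theta series folded at the middle: expanding the bracket gives its terms at
  \<open>-n\<close> and \<open>n + 1\<close>. The index \<open>d\<close> again stands for a
  difference, to keep the exponents natural.\<close>

definition theta_term :: "nat \<Rightarrow> nat \<Rightarrow> nat \<Rightarrow> rat fps" where
  "theta_term d s n = (-1) ^ n * (q ^ (n * (2 * Suc s * n + 2 * d * (n + 1) + 1)) *
     (1 - q ^ ((2 * s + 1) * (2 * n + 1))))"

lemma theta_term_agree_0: "agree n (theta_term d s n) 0"
  unfolding theta_term_def by (intro agree_mult_0 agree_X_power_0) simp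

text \<open>At level 0 the two series have a common power of \<open>q\<close> in each term once
  \<open>y = q ^ (2 * n + 1)\<close> is split off, and \<open>(1 - y^(2 s + 2)) + y (1 - y^(2 s)) =
  (1 - y^(2 s + 1)) (1 + y)\<close>. The factor \<open>1 + y\<close> is the one that
  \<open>weight_prod_1\<close> needs.\<close>

lemma gollnitz_level_0: "gollnitz L s 0 = (1 + q) * ratio_prod 1 * fps_series (theta_term (L - s) s)"
proof -
  have "hterm d (Suc s) 0 n + q * hterm (Suc d) s 0 n = (1 + q) * ratio_prod 1 * theta_term d s n" for d n
  proof -
    have e1: "hterm d (Suc s) 0 n = (-1) ^ n * (q ^ (n * (2 * Suc s * n + 2 * d * (n + 1) + 1)) *
        (1 - q ^ (2 * Suc s * (2 * n + 1))) * weight_prod 1 n)"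
      by (simp add: hterm_def)
    have "n * (2 * s * n + 2 * Suc d * (n + 1) + 1) + 1 =
       n * (2 * Suc s * n + 2 * d * (n + 1) + 1) + (2 * n + 1)"
      by (simp add: algebra_simps)
    then have "q * q ^ (n * (2 * s * n + 2 * Suc d * (n + 1) + 1)) =
       q ^ (n * (2 * Suc s * n + 2 * d * (n + 1) + 1)) * q ^ (2 * n + 1)"
      by (simp only: power_Suc[symmetric] power_add[symmetric] Suc_eq_plus1)
    moreover have "q * hterm (Suc d) s 0 n = (-1) ^ n * ((q * q ^ (n * (2 * s * n + 2 * Suc d * (n + 1) + 1))) *
        (1 - q ^ (2 * s * (2 * n + 1))) * weight_prod 1 n)"
      by (simp add: hterm_def mult_ac)
    ultimately have e2: "q * hterm (Suc d) s 0 n = (-1) ^ n * (q ^ (n * (2 * Suc s * n + 2 * d * (n + 1) + 1)) *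
        (q ^ (2 * n + 1) * (1 - q ^ (2 * s * (2 * n + 1)))) * weight_prod 1 n)"
      by (simp only: mult.assoc)
    have y: "(1 - y ^ (2 * Suc s)) + y * (1 - y ^ (2 * s)) = (1 - y ^ (2 * s + 1)) * (1 + y)"
      for y :: "rat fps"
      by (simp add: algebra_simps)
    have p: "q ^ (a * (2 * n + 1)) = (q ^ (2 * n + 1)) ^ a" for a
      unfolding power_mult[symmetric] by (subst mult.commute) (rule refl)
    have e3: "(1 - q ^ (2 * Suc s * (2 * n + 1))) + q ^ (2 * n + 1) * (1 - q ^ (2 * s * (2 * n + 1)))
       = (1 - q ^ ((2 * s + 1) * (2 * n + 1))) * (1 + q ^ (2 * n + 1))"
      unfolding p by (rule y)
    have "hterm d (Suc s) 0 n + q * hterm (Suc d) s 0 n =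
      (-1) ^ n * (q ^ (n * (2 * Suc s * n + 2 * d * (n + 1) + 1)) *
        ((1 - q ^ (2 * Suc s * (2 * n + 1))) + q ^ (2 * n + 1) * (1 - q ^ (2 * s * (2 * n + 1)))) * weight_prod 1 n)"
      unfolding e1 e2 by (simp only: distrib_left distrib_right)
    then have "hterm d (Suc s) 0 n + q * hterm (Suc d) s 0 n =
      theta_term d s n * ((1 + q ^ (2 * n + 1)) * weight_prod 1 n)"
      unfolding e3 theta_term_def by (simp only: mult.assoc)
    then show ?thesis
      by (simp only: weight_prod_1) (simp only: mult_ac)
  qed
  then show ?thesis
    unfolding gollnitz_def hfun_def
    by (simp only: fps_series_mult[OF hterm_agree_0] fps_series_mult[OF theta_term_agree_0] fps_series_add) simp
qed

subsection \<open>The Jacobi triple product\<close>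

definition tri :: "nat \<Rightarrow> nat" where "tri n = n * (n - 1) div 2"

lemma tri_Suc: "tri (Suc n) = tri n + n"
  by (cases n) (simp_all add: tri_def)

lemma tri_0 [simp]: "tri 0 = 0"
  by (simp add: tri_def)

lemma two_tri: "2 * tri (Suc n) = n * Suc n"
  by (induction n) (simp_all add: tri_Suc algebra_simps)

context
  fixes a c :: nat
begin

text \<open>The quadratic form \<open>(a + c) m (m - 1) / 2 + a m\<close> at the integer
  \<open>m = l - N\<close>. Replacing \<open>m\<close> by \<open>-m\<close> exchanges
  \<open>a\<close> and \<open>c\<close>, so a case distinction on the sign keeps everything in the
  natural numbers.\<close>

definition jexp :: "nat \<Rightarrow> nat \<Rightarrow> nat" where
  "jexp N l = (if N \<le> l then (a + c) * tri (l - N) + a * (l - N)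
     else (a + c) * tri (N - l) + c * (N - l))"

lemma jexp_Suc:
  assumes "l \<le> M + N"
  shows "jexp N (Suc l) + (a + c) * (M + N - l) = jexp N l + (a + (a + c) * M)"
proof (cases "N \<le> l")
  case True
  then obtain j where j: "l = N + j" using le_Suc_ex by blast
  with assms obtain m where "M = j + m" using le_Suc_ex by (metis add.commute add_le_cancel_left)
  then show ?thesis
    by (simp add: j jexp_def tri_Suc algebra_simps Suc_diff_le)
next
  case False
  then obtain n where n: "N = l + Suc n" using less_imp_Suc_add by (metis add_Suc_right not_le)
  then show ?thesis
    by (cases n) (simp_all add: jexp_def tri_Suc algebra_simps)
qed

text \<open>The reciprocal of \<open>(Q; Q)_n\<close> for \<open>Q = q^(a + c)\<close>, the base of
  the triple product.\<close>

definition qpoch_inv :: "nat \<Rightarrow> rat fps" where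
  "qpoch_inv n = (\<Prod>i<n. inverse (1 - q ^ ((a + c) * (i + 1))))"

lemma qpoch_inv_Suc:
  assumes "a > 0"
  shows "(1 - q ^ ((a + c) * Suc n)) * qpoch_inv (Suc n) = qpoch_inv n"
proof -
  have "(1 - q ^ ((a + c) * Suc n)) * qpoch_inv (Suc n) =
    ((1 - q ^ ((a + c) * Suc n)) * inverse (1 - q ^ ((a + c) * Suc n))) * qpoch_inv n"
    by (simp add: qpoch_inv_def mult_ac)
  moreover have "(1 - q ^ ((a + c) * Suc n)) * inverse (1 - q ^ ((a + c) * Suc n)) = 1"
    by (rule one_minus_X_power_inverse) (use assms in simp)
  ultimately show ?thesis by (simp only: mult_1)
qed

text \<open>
  The finite triple product with the usual summation index \<open>l - N\<close>.
\<close>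
definition jsum :: "nat \<Rightarrow> nat \<Rightarrow> rat fps" where
  "jsum M N = (\<Sum>l\<le>M + N. (-1) ^ (l + N) * (q ^ jexp N l * (qpoch_inv (M + N - l) * qpoch_inv l)))"

text \<open>The q-Pascal rule with \<open>Q = q^(a + c)\<close>: split
  \<open>1 - Q^(M + N + 1)\<close> into \<open>1 - Q^(M + N + 1 - l)\<close> and
  \<open>Q^(M + N + 1 - l) (1 - Q^l)\<close>. Each bracket cancels one reciprocal factor. The first
  part is \<open>jsum M N\<close>; the second, after shifting \<open>l\<close>, is
  \<open>jsum M N\<close> times \<open>- q^(a + (a + c) M)\<close>, by
  \<open>jexp_Suc\<close>.\<close>

lemma jsum_Suc_left:
  assumes "a > 0"
  shows "(1 - q ^ ((a + c) * Suc (M + N))) * jsum (Suc M) N = (1 - q ^ (a + (a + c) * M)) * jsum M N"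
proof -
  define t where "t = (\<lambda>l. (-1) ^ (l + N) * (q ^ jexp N l * (qpoch_inv (M + N - l) * qpoch_inv l)))"
  define u where "u = (\<lambda>l. (-1) ^ (l + N) * (q ^ jexp N l *
     ((1 - q ^ ((a + c) * (Suc (M + N) - l))) * qpoch_inv (Suc (M + N) - l) * qpoch_inv l)))"
  define v where "v = (\<lambda>l. (-1) ^ (l + N) * (q ^ jexp N l * (q ^ ((a + c) * (Suc (M + N) - l)) *
     qpoch_inv (Suc (M + N) - l) * ((1 - q ^ ((a + c) * l)) * qpoch_inv l))))"
  have "(1 - q ^ ((a + c) * Suc (M + N))) * jsum (Suc M) N = (\<Sum>l\<le>Suc (M + N). u l + v l)"
    unfolding jsum_def sum_distrib_left
  proof (intro sum.cong)
    fix l assume "l \<in> {..Suc (M + N)}"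
    then have "(a + c) * Suc (M + N) = (a + c) * (Suc (M + N) - l) + (a + c) * l"
      by (metis add_mult_distrib2 atMost_iff le_add_diff_inverse2)
    then have "1 - q ^ ((a + c) * Suc (M + N)) = (1 - q ^ ((a + c) * (Suc (M + N) - l))) +
       q ^ ((a + c) * (Suc (M + N) - l)) * (1 - q ^ ((a + c) * l))"
      by (simp add: power_add right_diff_distrib)
    then show "(1 - q ^ ((a + c) * Suc (M + N))) * ((-1) ^ (l + N) * (q ^ jexp N l *
        (qpoch_inv (Suc M + N - l) * qpoch_inv l))) = u l + v l"
      unfolding u_def v_def by (simp only: add_Suc) (simp only: distrib_right distrib_left mult_ac)
  qed simp
  also have "\<dots> = (\<Sum>l\<le>Suc (M + N). u l) + (\<Sum>l\<le>Suc (M + N). v l)"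
    by (rule sum.distrib)
  also have "(\<Sum>l\<le>Suc (M + N). u l) = (\<Sum>l\<le>M + N. t l)"
  proof -
    have "u (Suc (M + N)) = 0"
      by (simp add: u_def)
    moreover have "u l = t l" if "l \<le> M + N" for l
      using that qpoch_inv_Suc[OF assms, of "M + N - l"] by (simp add: u_def t_def Suc_diff_le)
    ultimately show ?thesis by (simp add: sum.atMost_Suc)
  qed
  also have "(\<Sum>l\<le>Suc (M + N). v l) = (\<Sum>l\<le>M + N. - (q ^ (a + (a + c) * M) * t l))"
  proof -
    have "v 0 = 0"
      by (simp add: v_def)
    moreover have "v (Suc l) = - (q ^ (a + (a + c) * M) * t l)" if "l \<le> M + N" for l
    proof -
      have "v (Suc l) = (-1) ^ (Suc l + N) * ((q ^ jexp N (Suc l) * q ^ ((a + c) * (M + N - l))) *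
          (qpoch_inv (M + N - l) * qpoch_inv l))"
        unfolding v_def using qpoch_inv_Suc[OF assms, of l] by (simp only: diff_Suc_Suc) (simp only: mult.assoc)
      also have "q ^ jexp N (Suc l) * q ^ ((a + c) * (M + N - l)) = q ^ jexp N l * q ^ (a + (a + c) * M)"
        using jexp_Suc[OF that] by (simp only: power_add[symmetric])
      finally show ?thesis
        by (simp add: t_def mult_ac)
    qed
    ultimately show ?thesis
      by (subst sum.atMost_Suc_shift) simp
  qed
  finally show ?thesis
    by (simp add: jsum_def t_def sum_negf sum_distrib_left[symmetric] left_diff_distrib)
qed

end

text \<open>Reversing the summation, \<open>l\<close> to \<open>M + N - l\<close>, changes the sign
  of the bilateral index. The recurrence in \<open>N\<close> then follows from the one in
  \<open>M\<close>.\<close>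

lemma jsum_commute: "jsum a c M N = jsum c a N M"
  unfolding jsum_def
proof (rule sum.reindex_bij_witness[of _ "\<lambda>l. M + N - l" "\<lambda>l. M + N - l"])
  fix l assume l: "l \<in> {..M + N}"
  have "(-1) ^ (l + N) = ((-1) ^ (M + N - l + M) :: rat fps)"
  proof -
    have "even (l + N) \<longleftrightarrow> even (M + N - l + M)" using l by auto
    then show ?thesis by (simp add: uminus_power_if)
  qed
  moreover have "jexp a c N l = jexp c a M (M + N - l)"
  proof (cases "N \<le> l")
    case True
    then show ?thesis
      using l by (cases "l = N") (simp_all add: jexp_def add.commute)
  next
    case False
    then show ?thesis
      using l by (simp add: jexp_def add.commute)
  qed
  ultimately show "(- 1) ^ (M + N - l + M) *
         (q ^ jexp c a M (M + N - l) *
          (qpoch_inv c a (N + M - (M + N - l)) * qpoch_inv c a (M + N - l))) =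
         (- 1) ^ (l + N) *
         (q ^ jexp a c N l * (qpoch_inv a c (M + N - l) * qpoch_inv a c l))"
    using l by (simp add: qpoch_inv_def add.commute mult.commute)
qed auto

lemma jsum_eq_prod:
  assumes "a > 0" "c > 0"
  shows "jsum a c M N = (\<Prod>i<M. 1 - q ^ (a + (a + c) * i)) * (\<Prod>i<N. 1 - q ^ (c + (a + c) * i)) *
    qpoch_inv a c (M + N)"
proof -
  have right: "(1 - q ^ ((a + c) * Suc (M + N))) * jsum a c M (Suc N) = (1 - q ^ (c + (a + c) * N)) * jsum a c M N" for M N
    using jsum_Suc_left[of c a N M] assms by (simp add: jsum_commute[of a c] add.commute)
  have nz: "1 - q ^ ((a + c) * Suc m) \<noteq> 0" for m
    using assms by (intro one_minus_X_power_nonzero) simp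
  have 1: "jsum a c 0 N = (\<Prod>i<N. 1 - q ^ (c + (a + c) * i)) * qpoch_inv a c N" for N
  proof (induction N)
    case 0
    show ?case by (simp add: jsum_def jexp_def qpoch_inv_def)
  next
    case (Suc N)
    have "(1 - q ^ ((a + c) * Suc N)) * jsum a c 0 (Suc N) =
      (1 - q ^ ((a + c) * Suc N)) * ((\<Prod>i<Suc N. 1 - q ^ (c + (a + c) * i)) * qpoch_inv a c (Suc N))"
      using right[of 0 N] Suc qpoch_inv_Suc[of a c N, OF assms(1)] by (simp add: mult_ac)
    then show ?case using nz[of N] by (subst (asm) mult_left_cancel)
  qed
  show ?thesis
  proof (induction M)
    case 0
    show ?case by (simp add: 1)
  next
    case (Suc M)
    have "(1 - q ^ ((a + c) * Suc (M + N))) * jsum a c (Suc M) N =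
      (1 - q ^ ((a + c) * Suc (M + N))) * ((\<Prod>i<Suc M. 1 - q ^ (a + (a + c) * i)) *
        (\<Prod>i<N. 1 - q ^ (c + (a + c) * i)) * qpoch_inv a c (Suc M + N))"
      using jsum_Suc_left[OF assms(1), of c M N] Suc qpoch_inv_Suc[of a c "M + N", OF assms(1)]
      by (simp add: mult_ac)
    then show ?case using nz[of "M + N"] by (subst (asm) mult_left_cancel)
  qed
qed

lemma qpoch_inv_agree:
  assumes "a > 0" "M \<le> Suc m" "M \<le> Suc n"
  shows "agree M (qpoch_inv a c m) (qpoch_inv a c n)"
proof -
  have *: "agree M (qpoch_inv a c m) (qpoch_inv a c n)" if "m \<le> n" "M \<le> Suc m" for m n
  proof -
    have "{..<n} = {..<m} \<union> {m..<n}" using that by auto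
    then have "qpoch_inv a c n = qpoch_inv a c m * (\<Prod>i\<in>{m..<n}. inverse (1 - q ^ ((a + c) * (i + 1))))"
      unfolding qpoch_inv_def by (simp add: prod.union_disjoint ivl_disj_int)
    moreover have "agree M (\<Prod>i\<in>{m..<n}. inverse (1 - q ^ ((a + c) * (i + 1)))) 1"
    proof (intro agree_prod_1 agree_inverse_diff_X_power)
      fix i assume "i \<in> {m..<n}"
      moreover have "1 * (i + 1) \<le> (a + c) * (i + 1)"
        using assms(1) by (intro mult_right_mono) auto
      ultimately show "M \<le> (a + c) * (i + 1)" using that by simp
    qed (use assms(1) in simp)
    ultimately show ?thesis
      using agree_mult[OF agree_refl, of M _ 1 "qpoch_inv a c m"] by (simp add: agree_sym)
  qed
  show ?thesis
    using *[of m n] *[of n m] assms by (cases "m \<le> n") (auto intro: agree_sym)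
qed

lemma jexp_ge: "a > 0 \<Longrightarrow> c > 0 \<Longrightarrow> l - N \<le> jexp a c N l" "a > 0 \<Longrightarrow> c > 0 \<Longrightarrow> N - l \<le> jexp a c N l"
  by (auto simp: jexp_def intro: trans_le_add2)

text \<open>The two halves \<open>f n\<close> and \<open>g n\<close> of a theta term are the
  summands at \<open>l = N - n\<close> and \<open>l = N + n + 1\<close>. Up to
  \<open>l = 2 * N\<close> only \<open>g N\<close> is left over, and it vanishes modulo
  \<open>q ^ Suc N\<close>. The values of \<open>a\<close> and \<open>c\<close> are those for which
  the exponents match; their sum is \<open>4 (d + s + 1)\<close>.\<close>

lemma theta_agree_jsum:
  assumes "a = 2 * s + 1" "c = 4 * d + 2 * s + 3"
  shows "agree (Suc N) (fps_series (theta_term d s)) (\<Sum>l\<le>2 * N. (-1) ^ (l + N) * q ^ jexp a c N l)"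
proof -
  define f where "f = (\<lambda>n. (-1) ^ n * q ^ ((a + c) * tri n + c * n))"
  define g where "g = (\<lambda>n. (-1) ^ Suc n * q ^ ((a + c) * tri (Suc n) + a * Suc n))"
  have ac: "a + c = 2 * (2 * Suc (d + s))"
    using assms by simp
  have "theta_term d s n = f n + g n" for n
  proof -
    have 1: "(a + c) * tri n + c * n = n * (2 * Suc s * n + 2 * d * (n + 1) + 1)"
    proof (cases n)
      case (Suc m)
      have "(a + c) * tri n = 2 * Suc (d + s) * (m * Suc m)"
        unfolding ac Suc two_tri[symmetric] by (simp only: mult_ac)
      then show ?thesis using Suc assms by (simp add: algebra_simps)
    qed simp
    have 2: "(a + c) * tri (Suc n) + a * Suc n =
      n * (2 * Suc s * n + 2 * d * (n + 1) + 1) + (2 * s + 1) * (2 * n + 1)"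
    proof -
      have "(a + c) * tri (Suc n) = 2 * Suc (d + s) * (n * Suc n)"
        unfolding ac two_tri[symmetric] by (simp only: mult_ac)
      then show ?thesis using assms by (simp add: algebra_simps)
    qed
    show ?thesis
      unfolding f_def g_def theta_term_def
      by (simp only: 1 2 power_add[of q _ "(2 * s + 1) * (2 * n + 1)"] right_diff_distrib) simp
  qed
  then have "(\<Sum>n\<le>N. theta_term d s n) = (\<Sum>n\<le>N. f n) + (\<Sum>n<N. g n) + g N"
    by (simp add: sum.distrib lessThan_Suc_atMost[symmetric])
  moreover have "agree (Suc N) (g N) 0"
  proof -
    have "1 * Suc N \<le> a * Suc N"
      using assms by (intro mult_right_mono) auto
    then show ?thesis
      unfolding g_def by (intro agree_mult_0 agree_X_power_0) simp
  qed
  moreover have "(\<Sum>l\<le>2 * N. (-1) ^ (l + N) * q ^ jexp a c N l) = (\<Sum>n\<le>N. f n) + (\<Sum>n<N. g n)"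
  proof -
    define h :: "nat \<Rightarrow> rat fps" where "h l = (-1) ^ (l + N) * q ^ jexp a c N l" for l
    have "{..2 * N} = {..N} \<union> {Suc N..2 * N}" by auto
    then have "(\<Sum>l\<le>2 * N. h l) = (\<Sum>l\<le>N. h l) + (\<Sum>l\<in>{Suc N..2 * N}. h l)"
      by (simp add: sum.union_disjoint ivl_disj_int)
    also have "(\<Sum>l\<le>N. h l) = (\<Sum>n\<le>N. f n)"
    proof (rule sum.reindex_bij_witness[of _ "\<lambda>n. N - n" "\<lambda>n. N - n"])
      fix l assume l: "l \<in> {..N}"
      have "even (l + N) \<longleftrightarrow> even (N - l)" using l by auto
      then have "(-1) ^ (l + N) = ((-1) ^ (N - l) :: rat fps)" by (simp add: uminus_power_if)
      then show "f (N - l) = h l"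
        using l by (cases "l = N") (auto simp: f_def h_def jexp_def)
    qed auto
    also have "(\<Sum>l\<in>{Suc N..2 * N}. h l) = (\<Sum>n<N. g n)"
    proof (rule sum.reindex_bij_witness[of _ "\<lambda>n. Suc (N + n)" "\<lambda>l. l - Suc N"])
      fix l assume "l \<in> {Suc N..2 * N}"
      then obtain n where n: "l = Suc (N + n)" by (auto simp: le_iff_add)
      have "(-1) ^ (l + N) = ((-1) ^ Suc n :: rat fps)"
        unfolding n by (simp add: uminus_power_if)
      then show "g (l - Suc N) = h l"
        unfolding g_def h_def jexp_def by (simp add: n)
    qed auto
    finally show ?thesis by (simp add: h_def)
  qed
  moreover have "agree (Suc N) (fps_series (theta_term d s)) (\<Sum>n\<le>N. theta_term d s n)"
    by (intro fps_series_agree theta_term_agree_0) simp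
  ultimately show ?thesis
    using agree_add[OF agree_refl, of "Suc N" "g N" 0] by (metis add_0_right agree_trans)
qed

lemma theta_agree_prod:
  assumes a: "a = 2 * s + 1" and c: "c = 4 * d + 2 * s + 3"
  shows "agree (Suc N) (fps_series (theta_term d s))
    (\<Prod>i<N. (1 - q ^ (a + (a + c) * i)) * (1 - q ^ (c + (a + c) * i)) * (1 - q ^ ((a + c) * (i + 1))))"
proof -
  define S where "S = (\<Sum>l\<le>2 * N. (-1) ^ (l + N) * q ^ jexp a c N l)"
  define E where "E = (\<Prod>i<N. 1 - q ^ ((a + c) * (i + 1)))"
  define A where "A = (\<Prod>i<N. 1 - q ^ (a + (a + c) * i)) * (\<Prod>i<N. 1 - q ^ (c + (a + c) * i))"
  have pos: "a > 0" "c > 0" using a c by auto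
  have "agree (Suc N) (jsum a c N N) (\<Sum>l\<le>2 * N. (-1) ^ (l + N) * (q ^ jexp a c N l *
     (qpoch_inv a c N * qpoch_inv a c N)))"
    unfolding jsum_def mult_2[symmetric]
  proof (rule agree_sum, rule agree_mult[OF agree_refl])
    fix l assume l: "l \<in> {..2 * N}"
    show "agree (Suc N) (q ^ jexp a c N l * (qpoch_inv a c (2 * N - l) * qpoch_inv a c l))
       (q ^ jexp a c N l * (qpoch_inv a c N * qpoch_inv a c N))"
    proof (rule agree_X_power_mult)
      \<comment> \<open>The reciprocals with indices \<open>l\<close> and \<open>2 * N - l\<close>
        are close to their limit only when both indices are large, but \<open>jexp\<close> is at
        least the distance of \<open>l\<close> from \<open>N\<close>, so the power of
        \<open>q\<close> supplies the missing precision.\<close>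
      show "agree (Suc N - jexp a c N l) (qpoch_inv a c (2 * N - l) * qpoch_inv a c l)
         (qpoch_inv a c N * qpoch_inv a c N)"
        using l jexp_ge[OF pos, of l N] jexp_ge(2)[OF pos, of N l] by (intro agree_mult qpoch_inv_agree pos) auto
    qed simp
  qed
  also have "(\<Sum>l\<le>2 * N. (-1) ^ (l + N) * (q ^ jexp a c N l *
     (qpoch_inv a c N * qpoch_inv a c N))) = qpoch_inv a c N * qpoch_inv a c N * S"
    unfolding S_def sum_distrib_left by (intro sum.cong refl) (simp only: mult_ac)
  finally have 1: "agree (Suc N) (A * qpoch_inv a c (N + N)) (qpoch_inv a c N * qpoch_inv a c N * S)"
    unfolding jsum_eq_prod[OF pos] A_def .
  have "E * qpoch_inv a c N = (\<Prod>i<N. (1 - q ^ ((a + c) * (i + 1))) * inverse (1 - q ^ ((a + c) * (i + 1))))"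
    unfolding E_def qpoch_inv_def by (rule prod.distrib[symmetric])
  also have "\<dots> = 1"
    by (rule prod.neutral, rule ballI, rule one_minus_X_power_inverse) (use pos in simp)
  finally have E: "E * qpoch_inv a c N = 1" .
  have "S = (E * qpoch_inv a c N) * (E * qpoch_inv a c N) * S"
    by (simp add: E)
  also have "\<dots> = E * E * (qpoch_inv a c N * qpoch_inv a c N * S)"
    by (simp only: mult_ac)
  also have "agree (Suc N) \<dots> (E * E * (A * qpoch_inv a c (N + N)))"
    by (intro agree_mult agree_refl agree_sym[OF 1])
  also have "agree (Suc N) \<dots> (E * E * (A * qpoch_inv a c N))"
    by (intro agree_mult agree_refl qpoch_inv_agree pos) simp_all
  also have "E * E * (A * qpoch_inv a c N) = A * E * (E * qpoch_inv a c N)"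
    by (simp only: mult_ac)
  also have "\<dots> = (\<Prod>i<N. (1 - q ^ (a + (a + c) * i)) * (1 - q ^ (c + (a + c) * i)) * (1 - q ^ ((a + c) * (i + 1))))"
    by (simp only: E mult_1_right) (simp only: A_def E_def prod.distrib)
  finally show ?thesis
    unfolding S_def using theta_agree_jsum[OF assms] agree_trans by blast
qed

section \<open>The product for the overpartitions of the first kind\<close>

lemma prod_even_parts:
  "(\<Prod>m<2 * N. if even (m + 1) then 1 + q ^ (m + 1) else 1) = (\<Prod>i<N. 1 + q ^ (2 * (0 + i + 1)))"
  by (induction N) simp_all

lemma prod_parts_not_2_mod_4:
  "(\<Prod>m<4 * N. if (m + 1) mod 4 \<noteq> 2 then inverse (1 - q ^ (m + 1)) else 1) =
   (\<Prod>i<2 * N. inverse (1 - q ^ (2 * i + 1))) * (\<Prod>i<N. inverse (1 - q ^ (4 * (i + 1))))"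
proof (induction N)
  case (Suc N)
  have *: "4 * Suc N = Suc (Suc (Suc (Suc (4 * N))))" "2 * Suc N = Suc (Suc (2 * N))" by simp_all
  have m: "(4 * N + 1) mod 4 \<noteq> 2" "\<not> (Suc (4 * N) + 1) mod 4 \<noteq> 2" "(Suc (Suc (4 * N)) + 1) mod 4 \<noteq> 2"
    "(Suc (Suc (Suc (4 * N))) + 1) mod 4 \<noteq> 2" by presburger+
  have e: "Suc (Suc (4 * N)) + 1 = 2 * Suc (2 * N) + 1" "4 * N + 1 = 2 * (2 * N) + 1"
    "Suc (Suc (Suc (4 * N))) + 1 = 4 * (N + 1)" by simp_all
  show ?case
    unfolding * prod.lessThan_Suc Suc
    unfolding if_P[OF m(1)] if_not_P[OF m(2)] if_P[OF m(3)] if_P[OF m(4)]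
    unfolding e
    by (simp only: mult_ac mult_1_right mult_1_left)
qed simp

text \<open>Since \<open>(1 + q^(2 i + 1)) (1 - q^(2 i + 1)) = 1 - q^(4 i + 2)\<close>, trading the
  reciprocal odd factors for factors \<open>1 + q^(2 i + 1)\<close> costs exactly the reciprocal
  factors for the parts congruent to 2 modulo 4. In the truncated products the surplus is
  \<open>g'\<close>, which is 1 to the required precision.\<close>

lemma prod_odd_parts_agree:
  "agree (Suc N) (\<Prod>m<4 * N. if (m + 1) mod 4 \<noteq> 2 then inverse (1 - q ^ (m + 1)) else 1) ((1 + q) * ratio_prod 1)"
proof -
  define p where "p = (\<Prod>i<2 * N. 1 + q ^ (2 * i + 1))"
  define o' where "o' = (\<Prod>i<2 * N. inverse (1 - q ^ (2 * i + 1)))"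
  define e' where "e' = (\<Prod>i<2 * N. inverse (1 - q ^ (2 * (i + 1))))"
  define f where "f = (\<Prod>i<N. 1 - q ^ (4 * (i + 1)))"
  define f' where "f' = (\<Prod>i<N. inverse (1 - q ^ (4 * (i + 1))))"
  define g where "g = (\<Prod>i<N. 1 - q ^ (4 * i + 2))"
  define g' where "g' = (\<Prod>i\<in>{N..<2 * N}. 1 - q ^ (4 * i + 2))"
  have inv: "(\<Prod>i\<in>I. 1 - q ^ (h i)) * (\<Prod>i\<in>I. inverse (1 - q ^ (h i))) = 1"
    if "\<And>i. i \<in> I \<Longrightarrow> h i > 0" for I and h :: "nat \<Rightarrow> nat"
    unfolding prod.distrib[symmetric] using that by (intro prod.neutral ballI one_minus_X_power_inverse)
  have ff: "f * f' = 1" unfolding f_def f'_def by (rule inv) simp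
  have eq1: "p * (\<Prod>i<2 * N. 1 - q ^ (2 * i + 1)) = g * g'"
  proof -
    have "{..<2 * N} = {..<N} \<union> {N..<2 * N}" by auto
    then have "g * g' = (\<Prod>i<2 * N. 1 - q ^ (4 * i + 2))"
      unfolding g_def g'_def by (simp add: prod.union_disjoint ivl_disj_int)
    also have "\<dots> = p * (\<Prod>i<2 * N. 1 - q ^ (2 * i + 1))"
      unfolding p_def prod.distrib[symmetric]
    proof (rule prod.cong)
      fix i :: nat
      have "4 * i + 2 = (2 * i + 1) + (2 * i + 1)" by simp
      then have "q ^ (4 * i + 2) = q ^ (2 * i + 1) * q ^ (2 * i + 1)" by (simp only: power_add)
      then show "1 - q ^ (4 * i + 2) = (1 + q ^ (2 * i + 1)) * (1 - q ^ (2 * i + 1))"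
        by (simp only: distrib_right right_diff_distrib) simp
    qed simp
    finally show ?thesis by simp
  qed
  have eq2: "(\<Prod>i<2 * N. 1 - q ^ (2 * (i + 1))) = f * g"
    unfolding f_def g_def
  proof (induction N)
    case (Suc N)
    have *: "2 * Suc N = Suc (Suc (2 * N))" by simp
    have e: "2 * (2 * N + 1) = 4 * N + 2" "2 * (Suc (2 * N) + 1) = 4 * (N + 1)" by simp_all
    show ?case
      unfolding * prod.lessThan_Suc Suc e by (simp only: mult_ac)
  qed simp
  have eq3: "o' * f' * g' = p * e'"
  proof -
    have "p * e' = p * e' * ((\<Prod>i<2 * N. 1 - q ^ (2 * i + 1)) * o') * (f * f')"
      unfolding ff o'_def by (subst inv) simp_all
    also have "\<dots> = (p * (\<Prod>i<2 * N. 1 - q ^ (2 * i + 1))) * e' * o' * f * f'"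
      by (simp only: mult_ac)
    also have "\<dots> = ((f * g) * e') * (o' * f' * g')"
      unfolding eq1 by (simp only: mult_ac)
    also have "(f * g) * e' = 1"
      unfolding eq2[symmetric] e'_def by (rule inv) simp
    finally show ?thesis by simp
  qed
  have "agree (Suc N) g' 1"
    unfolding g'_def by (rule agree_prod_1, rule agree_diff_X_power) auto
  then have "agree (Suc N) (o' * f' * g') (o' * f' * 1)"
    by (rule agree_mult[OF agree_refl])
  then have "agree (Suc N) (o' * f') (p * e')"
    unfolding eq3 mult_1_right by (rule agree_sym)
  also have "agree (Suc N) (p * e') ((1 + q) * ratio_prod 1)"
  proof -
    have "(1 + q) * (\<Prod>i<2 * N. (1 + q ^ (2 * (1 + i) + 1)) * inverse (1 - q ^ (2 * (1 + i)))) =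
       (\<Prod>i<Suc (2 * N). 1 + q ^ (2 * i + 1)) * e'"
      unfolding e'_def prod.distrib by (subst prod.lessThan_Suc_shift) (simp add: mult_ac)
    also have "\<dots> = p * e' * (1 + q ^ (2 * (2 * N) + 1))"
      unfolding p_def prod.lessThan_Suc by (simp only: mult_ac)
    finally have "agree (Suc N) ((1 + q) * (\<Prod>i<2 * N. (1 + q ^ (2 * (1 + i) + 1)) * inverse (1 - q ^ (2 * (1 + i))))) (p * e')"
      using agree_mult[OF agree_refl agree_add_X_power, of "Suc N" "2 * (2 * N) + 1" "p * e'"]
      by (simp only: mult_1_right)
    moreover have "agree (Suc N) ((1 + q) * ratio_prod 1)
      ((1 + q) * (\<Prod>i<2 * N. (1 + q ^ (2 * (1 + i) + 1)) * inverse (1 - q ^ (2 * (1 + i)))))"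
      unfolding ratio_prod_def by (rule agree_mult[OF agree_refl fps_iprod_agree], rule ratio_prod_factor_agree) auto
    ultimately show ?thesis by (meson agree_sym agree_trans)
  qed
  finally show ?thesis
    unfolding prod_parts_not_2_mod_4 o'_def f'_def .
qed

lemma prod_residue_classes:
  fixes a c :: nat
  assumes "0 < a" "0 < c" "a \<noteq> c"
  shows "(\<Prod>m<(a + c) * N. if (m + 1) mod (a + c) \<in> {0, a, c} then f (m + 1) else (1 :: 'a::comm_monoid_mult)) =
    (\<Prod>i<N. f (a + (a + c) * i) * f (c + (a + c) * i) * f ((a + c) * (i + 1)))"
proof -
  define b where "b = a + c"
  have b: "a < b" "c < b" using assms by (auto simp: b_def)
  have "(\<Prod>m\<in>{i * b..<i * b + b}. if (m + 1) mod b \<in> {0, a, c} then f (m + 1) else 1) =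
     f (a + b * i) * f (c + b * i) * f (b * (i + 1))" for i
  proof -
    have A: "{m \<in> {i * b..<i * b + b}. (m + 1) mod b \<in> {0, a, c}} =
       {i * b + (a - 1), i * b + (c - 1), i * b + (b - 1)}" (is "?A = ?B")
    proof
      show "?A \<subseteq> ?B"
      proof
        fix m assume m: "m \<in> ?A"
        then obtain y where y: "m = i * b + y" "y < b" by (auto simp: le_iff_add)
        have "(m + 1) mod b = (y + 1) mod b"
          unfolding y by (metis add.assoc add.commute mod_mult_self2 mult.commute)
        then have "(y + 1) mod b \<in> {0, a, c}" using m by simp
        moreover have "(y + 1) mod b = (if y + 1 = b then 0 else y + 1)"
          using y by auto
        ultimately have "y = a - 1 \<or> y = c - 1 \<or> y = b - 1"
          by (auto split: if_splits)
        then show "m \<in> ?B" using y by auto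
      qed
      have "(i * b + (z - 1) + 1) mod b = z mod b" if "z > 0" for z
        using that by simp
      then show "?B \<subseteq> ?A"
        using b assms(1,2) by auto
    qed
    have B: "(\<Prod>m\<in>{x, y, z}. f (m + 1)) = f (x + 1) * f (y + 1) * f (z + 1)"
      if "x \<noteq> y" "x \<noteq> z" "y \<noteq> z" for x y z
      using that by (simp add: mult.assoc)
    have ne: "i * b + (a - 1) \<noteq> i * b + (c - 1)" "i * b + (a - 1) \<noteq> i * b + (b - 1)"
      "i * b + (c - 1) \<noteq> i * b + (b - 1)" using assms b by auto
    have e: "i * b + (a - 1) + 1 = a + b * i" "i * b + (c - 1) + 1 = c + b * i"
      "i * b + (b - 1) + 1 = b * (i + 1)" using assms b by (simp_all add: algebra_simps)
    have "(\<Prod>m\<in>{i * b..<i * b + b}. if (m + 1) mod b \<in> {0, a, c} then f (m + 1) else 1) =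
      (\<Prod>m\<in>{m \<in> {i * b..<i * b + b}. (m + 1) mod b \<in> {0, a, c}}. f (m + 1))"
      by (rule prod.inter_filter[symmetric]) simp
    also have "\<dots> = f (a + b * i) * f (c + b * i) * f (b * (i + 1))"
      unfolding A B[OF ne] e ..
    finally show ?thesis .
  qed
  moreover have "(\<Prod>m<N * b. if (m + 1) mod b \<in> {0, a, c} then f (m + 1) else 1) =
    (\<Prod>i<N. \<Prod>m\<in>{i * b..<i * b + b}. if (m + 1) mod b \<in> {0, a, c} then f (m + 1) else 1)"
    by (rule prod.nat_group[symmetric])
  ultimately show ?thesis
    unfolding b_def[symmetric] mult.commute[of b N] by (simp only:)
qed

text \<open>A forbidden residue class is removed by multiplying by \<open>1 - q^m\<close>. This
  cancels an existing reciprocal, because \<open>a\<close> and \<open>c\<close> are odd and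
  \<open>a + c\<close> is divisible by 4, so no number in the classes 0, \<open>a\<close>,
  \<open>c\<close> is 2 modulo 4. Truncating at a multiple of \<open>a + c\<close> keeps only
  complete periods of all the conditions.\<close>

lemma A_product_agree:
  assumes a: "a = 2 * s + 1" and c: "c = 4 * d + 2 * s + 3"
  shows "agree (Suc N) (\<Prod>m<(a + c) * N. (if even (m + 1) then 1 + q ^ (m + 1) else 1) *
      (if (m + 1) mod 4 \<noteq> 2 \<and> (m + 1) mod (a + c) \<notin> {0, a, c} then inverse (1 - q ^ (m + 1)) else 1))
    (even_prod 0 * ((1 + q) * ratio_prod 1 * fps_series (theta_term d s)))"
proof -
  define K where "K = Suc (d + s)"
  have b: "a + c = 4 * K" using a c by (simp add: K_def)
  have *: "(if (m + 1) mod 4 \<noteq> 2 \<and> (m + 1) mod (a + c) \<notin> {0, a, c} then inverse (1 - q ^ (m + 1)) else 1) =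
    (if (m + 1) mod 4 \<noteq> 2 then inverse (1 - q ^ (m + 1)) else 1) *
    (if (m + 1) mod (a + c) \<in> {0, a, c} then 1 - q ^ (m + 1) else 1)" for m
  proof (cases "(m + 1) mod (a + c) \<in> {0, a, c}")
    case True
    have "(m + 1) mod (a + c) mod 4 = (m + 1) mod 4"
      unfolding b by (simp add: mod_mult2_eq)
    moreover have "a mod 4 \<noteq> 2" "c mod 4 \<noteq> 2"
      unfolding a c by presburger+
    ultimately have "(m + 1) mod 4 \<noteq> 2" using True by force
    moreover have "inverse (1 - q ^ (m + 1)) * (1 - q ^ (m + 1)) = 1"
      by (subst mult.commute, rule one_minus_X_power_inverse) simp
    ultimately show ?thesis using True by (simp only: if_True if_False simp_thms)
  qed simp
  have "agree (Suc N) ((\<Prod>m<2 * (2 * (K * N)). if even (m + 1) then 1 + q ^ (m + 1) else 1) *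
    ((\<Prod>m<4 * (K * N). if (m + 1) mod 4 \<noteq> 2 then inverse (1 - q ^ (m + 1)) else 1) *
     (\<Prod>m<(a + c) * N. if (m + 1) mod (a + c) \<in> {0, a, c} then 1 - q ^ (m + 1) else 1)))
    (even_prod 0 * ((1 + q) * ratio_prod 1 * fps_series (theta_term d s)))"
  proof (intro agree_mult)
    have "Suc N \<le> Suc (K * N)" by (simp add: K_def)
    then show "agree (Suc N) (\<Prod>m<4 * (K * N). if (m + 1) mod 4 \<noteq> 2 then inverse (1 - q ^ (m + 1)) else 1)
     ((1 + q) * ratio_prod 1)"
      by (rule agree_mono[OF prod_odd_parts_agree])
    show "agree (Suc N) (\<Prod>m<2 * (2 * (K * N)). if even (m + 1) then 1 + q ^ (m + 1) else 1) (even_prod 0)"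
      unfolding even_prod_def prod_even_parts
      by (rule agree_sym, rule fps_iprod_agree, rule agree_add_X_power) (auto simp: K_def)
    have "(\<Prod>m<(a + c) * N. if (m + 1) mod (a + c) \<in> {0, a, c} then 1 - q ^ (m + 1) else 1) =
      (\<Prod>i<N. (1 - q ^ (a + (a + c) * i)) * (1 - q ^ (c + (a + c) * i)) * (1 - q ^ ((a + c) * (i + 1))))"
      using a c by (intro prod_residue_classes) auto
    then show "agree (Suc N) (\<Prod>m<(a + c) * N. if (m + 1) mod (a + c) \<in> {0, a, c} then 1 - q ^ (m + 1) else 1)
      (fps_series (theta_term d s))"
      using agree_sym[OF theta_agree_prod[OF assms]] by simp
  qed
  moreover have "2 * (2 * (K * N)) = (a + c) * N" "4 * (K * N) = (a + c) * N"
    unfolding b by simp_all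
  ultimately show ?thesis
    unfolding * prod.distrib by simp
qed

subsection \<open>Generating functions of overpartitions\<close>

definition gf :: "part list set \<Rightarrow> rat fps" where
  "gf S = Abs_fps (\<lambda>n. of_nat (card {\<pi> \<in> S. weight \<pi> = n}))"

lemma finite_overpartition_weight:
  assumes "\<And>\<pi>. \<pi> \<in> S \<Longrightarrow> sorted_wrt may_precede \<pi> \<and> (\<forall>x\<in>set \<pi>. part_size x > 0)"
  shows "finite {\<pi> \<in> S. weight \<pi> = n}"
  using assms by (intro finite_subset[OF _ finite_overpartitions[of n]]) (auto simp: overpartitions_iff)

definition overpartitions_in :: "part set \<Rightarrow> part list set" where
  "overpartitions_in U = {\<pi>. sorted_wrt may_precede \<pi> \<and> set \<pi> \<subseteq> U}"

text \<open>As \<open>z\<close> exceeds all of \<open>U\<close>, it can only stand at the front.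
  Removing one leading \<open>z\<close> leaves a list over \<open>U\<close> if \<open>z\<close> is
  overlined and a list that may still contain \<open>z\<close> otherwise; the latter gives the
  geometric series.\<close>

lemma gf_insert_top:
  assumes z: "part_size z > 0" and U: "\<And>x. x \<in> U \<Longrightarrow> part_size x > 0 \<and> x < z"
  shows "gf (overpartitions_in (insert z U)) =
    (if overlined z then 1 + q ^ part_size z else inverse (1 - q ^ part_size z)) * gf (overpartitions_in U)"
proof -
  define m where "m = part_size z"
  define U' where "U' = (if overlined z then U else insert z U)"
  have rec: "gf (overpartitions_in (insert z U)) = gf (overpartitions_in U) + q ^ m * gf (overpartitions_in U')"
  proof (rule fps_ext)
    fix n
    define A where "A = {\<pi> \<in> overpartitions_in U. weight \<pi> = n}"
    define B where "B = (#) z ` {\<pi> \<in> overpartitions_in U'. m + weight \<pi> = n}"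
    have fin: "finite {\<pi> \<in> overpartitions_in V. weight \<pi> = n}" if "V \<subseteq> insert z U" for V n
      using that z U by (intro finite_overpartition_weight) (auto simp: overpartitions_in_def)
    have "{\<pi> \<in> overpartitions_in (insert z U). weight \<pi> = n} = A \<union> B"
    proof (intro equalityI subsetI)
      fix \<pi> assume \<pi>: "\<pi> \<in> {\<pi> \<in> overpartitions_in (insert z U). weight \<pi> = n}"
      show "\<pi> \<in> A \<union> B"
      proof (cases "z \<in> set \<pi>")
        case False
        then show ?thesis using \<pi> by (auto simp: A_def overpartitions_in_def)
      next
        case True
        then obtain x \<pi>' where \<pi>': "\<pi> = x # \<pi>'" by (cases \<pi>) auto
        have "x \<in> insert z U" "z = x \<or> may_precede x z"
          using True \<pi> unfolding \<pi>' by (auto simp: overpartitions_in_def)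
        then have "x = z"
          using U[of x] by (auto simp: may_precede_def)
        moreover have "z \<notin> set \<pi>'" if "overlined z"
          using that \<pi> unfolding \<pi>' \<open>x = z\<close> by (auto simp: overpartitions_in_def may_precede_def)
        ultimately have "\<pi> = z # \<pi>'" "\<pi>' \<in> {\<pi> \<in> overpartitions_in U'. m + weight \<pi> = n}"
          using \<pi> unfolding \<pi>' by (auto simp: overpartitions_in_def U'_def m_def)
        then show ?thesis unfolding B_def by blast
      qed
    next
      have U': "may_precede z x \<and> x \<in> insert z U" if "x \<in> U'" for x
        using that U[of x] by (auto simp: U'_def may_precede_def split: if_splits)
      fix \<pi> assume "\<pi> \<in> A \<union> B"
      then show "\<pi> \<in> {\<pi> \<in> overpartitions_in (insert z U). weight \<pi> = n}"
      proof
        assume "\<pi> \<in> B"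
        then obtain \<pi>' where \<pi>': "\<pi> = z # \<pi>'" "sorted_wrt may_precede \<pi>'" "set \<pi>' \<subseteq> U'" "m + weight \<pi>' = n"
          by (auto simp: B_def overpartitions_in_def)
        have "set \<pi>' \<subseteq> insert z U" "\<forall>x\<in>set \<pi>'. may_precede z x"
          using U' \<pi>'(3) by blast+
        then show ?thesis
          using \<pi>' by (simp add: overpartitions_in_def m_def)
      qed (auto simp: A_def overpartitions_in_def)
    qed
    moreover have "A \<inter> B = {}"
      using U[of z] by (auto simp: A_def B_def overpartitions_in_def)
    moreover have "finite A"
      unfolding A_def by (intro fin) auto
    moreover have "card B = (if n < m then 0 else card {\<pi> \<in> overpartitions_in U'. weight \<pi> = n - m})"
    proof -
      have "card B = card {\<pi> \<in> overpartitions_in U'. m + weight \<pi> = n}"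
        unfolding B_def by (rule card_image) auto
      moreover have "{\<pi> \<in> overpartitions_in U'. m + weight \<pi> = n} =
        (if n < m then {} else {\<pi> \<in> overpartitions_in U'. weight \<pi> = n - m})"
        by auto
      ultimately show ?thesis by simp
    qed
    moreover have "finite B"
    proof -
      have "{\<pi> \<in> overpartitions_in U'. m + weight \<pi> = n} \<subseteq> {\<pi> \<in> overpartitions_in U'. weight \<pi> = n - m}"
        by auto
      then show ?thesis
        unfolding B_def by (intro finite_imageI) (rule finite_subset[OF _ fin], auto simp: U'_def split: if_splits)
    qed
    ultimately show "gf (overpartitions_in (insert z U)) $ n = (gf (overpartitions_in U) + q ^ m * gf (overpartitions_in U')) $ n"
      by (simp add: gf_def fps_X_power_mult_nth card_Un_disjoint) (simp add: A_def)
  qed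
  show ?thesis
  proof (cases "overlined z")
    case True
    then show ?thesis
      using rec by (simp add: U'_def m_def distrib_right)
  next
    case False
    then have "(1 - q ^ m) * gf (overpartitions_in (insert z U)) = gf (overpartitions_in U)"
      using rec by (simp add: U'_def left_diff_distrib diff_eq_eq)
    moreover have "inverse (1 - q ^ m) * (1 - q ^ m) = 1"
      using z by (subst mult.commute, intro one_minus_X_power_inverse) (simp add: m_def)
    ultimately have "gf (overpartitions_in (insert z U)) = inverse (1 - q ^ m) * gf (overpartitions_in U)"
      by (metis mult.assoc mult_1)
    then show ?thesis using False by (simp add: m_def)
  qed
qed

lemma gf_overpartitions_in_bounded:
  "gf (overpartitions_in {(m, b). 0 < m \<and> m \<le> N \<and> (if b then V m else W m)}) =
   (\<Prod>m<N. (if V (m + 1) then 1 + q ^ (m + 1) else 1) * (if W (m + 1) then inverse (1 - q ^ (m + 1)) else 1))"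
proof (induction N)
  case 0
  have "{(m, b). 0 < m \<and> m \<le> 0 \<and> (if b then V m else W m)} = {}" by auto
  moreover have "overpartitions_in {} = {[]}" by (auto simp: overpartitions_in_def)
  moreover have "gf {[]} = 1"
  proof (rule fps_ext)
    fix n
    have "{\<pi> \<in> {[]}. weight \<pi> = n} = (if n = 0 then {[]} else {})" by auto
    then show "gf {[]} $ n = 1 $ n" by (simp add: gf_def)
  qed
  ultimately show ?case by (simp only:) simp
next
  case (Suc N)
  define U where "U = {(m, b). 0 < m \<and> m \<le> N \<and> (if b then V m else W m)}"
  define U' where "U' = U \<union> (if W (Suc N) then {(Suc N, False)} else {})"
  have "{(m, b). 0 < m \<and> m \<le> Suc N \<and> (if b then V m else W m)} =
     U' \<union> (if V (Suc N) then {(Suc N, True)} else {})"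
    by (auto simp: U'_def U_def le_Suc_eq split: if_splits)
  moreover have "gf (overpartitions_in (U' \<union> (if V (Suc N) then {(Suc N, True)} else {}))) =
    (if V (Suc N) then 1 + q ^ Suc N else 1) * gf (overpartitions_in U')"
  proof (cases "V (Suc N)")
    case True
    have "gf (overpartitions_in (insert (Suc N, True) U')) = (1 + q ^ Suc N) * gf (overpartitions_in U')"
      by (subst gf_insert_top) (auto simp: U'_def U_def less_prod_def split: if_splits)
    then show ?thesis using True by simp
  qed simp
  moreover have "gf (overpartitions_in U') =
    (if W (Suc N) then inverse (1 - q ^ Suc N) else 1) * gf (overpartitions_in U)"
  proof (cases "W (Suc N)")
    case True
    have "gf (overpartitions_in (insert (Suc N, False) U)) = inverse (1 - q ^ Suc N) * gf (overpartitions_in U)"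
      by (subst gf_insert_top) (auto simp: U_def less_prod_def split: if_splits)
    then show ?thesis using True by (simp add: U'_def)
  qed (simp add: U'_def)
  ultimately show ?case
    using Suc by (simp add: U_def mult_ac)
qed

lemma A_bar_eq_coeff:
  assumes "n \<le> N"
  shows "of_nat (A_bar k r n) = gf (overpartitions_in {(m, b). 0 < m \<and> m \<le> N \<and>
     (if b then even m else \<not> [int m = 2] (mod 4) \<and>
        \<not> [int m = 0] (mod (4 * int k - 4)) \<and>
        \<not> [int m = 2 * int r - 1] (mod (4 * int k - 4)) \<and>
        \<not> [int m = - (2 * int r - 1)] (mod (4 * int k - 4)))}) $ n"
    (is "_ = gf (overpartitions_in ?U) $ n")
proof -
  have le: "part_size x \<le> weight \<pi>" if "x \<in> set \<pi>" for x :: part and \<pi>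
    using that member_le_sum_list[of "part_size x" "map part_size \<pi>"] by auto
  have "A_bar_set k r n = {\<pi> \<in> overpartitions_in ?U. weight \<pi> = n}"
  proof (intro equalityI subsetI)
    fix \<pi> assume \<pi>: "\<pi> \<in> A_bar_set k r n"
    then have "part_size x \<le> N" if "x \<in> set \<pi>" for x
      using le[OF that] assms by (simp add: A_bar_set_def overpartitions_iff)
    then show "\<pi> \<in> {\<pi> \<in> overpartitions_in ?U. weight \<pi> = n}"
      using \<pi> by (fastforce simp: A_bar_set_def overpartitions_iff overpartitions_in_def split: if_splits)
  next
    fix \<pi> assume "\<pi> \<in> {\<pi> \<in> overpartitions_in ?U. weight \<pi> = n}"
    then show "\<pi> \<in> A_bar_set k r n"
      by (fastforce simp: A_bar_set_def overpartitions_iff overpartitions_in_def split: if_splits)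
  qed
  then show ?thesis by (simp add: A_bar_def gf_def)
qed

section \<open>The recurrence obtained by removing tails\<close>

definition tails :: "nat \<Rightarrow> nat \<Rightarrow> nat \<Rightarrow> nat \<Rightarrow> (nat \<times> nat \<times> nat) set" where
  "tails k j s c = {(u, f, v). u \<le> 1 \<and> v \<le> 1 \<and> u + f \<le> s \<and> u + f + v + parity_defect k j c (u + f) \<le> k - 1}"

definition next_level :: "nat \<Rightarrow> nat \<Rightarrow> nat \<Rightarrow> nat \<times> nat \<times> nat \<Rightarrow> part list set" where
  "next_level k j c = (\<lambda>(u, f, v).
     level_set k (j + 1) (k - 1 - parity_defect k j c (u + f) - f - v) (c + u + v))"

lemma finite_tails: "finite (tails k j s c)"
proof (rule finite_subset)
  show "tails k j s c \<subseteq> {..1} \<times> {..s} \<times> {..1}" by (auto simp: tails_def)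
qed simp

lemma tail_inj:
  assumes "tail j \<tau> = tail j \<tau>'" shows "\<tau> = \<tau>'"
proof -
  obtain u f v where \<tau>: "\<tau> = (u, f, v)" by (cases \<tau>)
  obtain u' f' v' where \<tau>': "\<tau>' = (u', f', v')" by (cases \<tau>')
  have "length (filter ((=) x) (tail j \<tau>)) = length (filter ((=) x) (tail j \<tau>'))" for x
    using assms by simp
  from this[of "(2 * j + 1, True)"] this[of "(2 * j + 2, False)"] this[of "(2 * j + 2, True)"]
  show ?thesis by (simp add: tail_def \<tau> \<tau>' filter_replicate)
qed

lemma size_tail: "x \<in> set (tail j \<tau>) \<Longrightarrow> part_size x \<le> 2 * j + 2"
  by (cases \<tau>) (auto simp: tail_def)

lemma level_set_size: "\<pi> \<in> level_set k j s c \<Longrightarrow> x \<in> set \<pi> \<Longrightarrow> 2 * j < part_size x"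
  by (auto simp: level_set_def)

lemma finite_level_set_weight: "finite {\<pi> \<in> level_set k j s c. weight \<pi> = n}"
proof (rule finite_overpartition_weight)
  fix \<pi> assume \<pi>: "\<pi> \<in> level_set k j s c"
  then have "\<forall>x\<in>set \<pi>. part_size x > 0" using level_set_size[OF \<pi>] by fastforce
  then show "sorted_wrt may_precede \<pi> \<and> (\<forall>x\<in>set \<pi>. part_size x > 0)"
    using \<pi> by (simp add: level_set_def)
qed

text \<open>Part sizes show where to cut a list into a remainder and a tail, and the tail determines
  its multiplicities, so appending is a bijection from pairs of an admissible tail and an object of
  the next level.\<close>

lemma gf_level_set:
  assumes k: "k > 2"
  shows "gf (level_set k j s c) = (\<Sum>\<tau>\<in>tails k j s c. q ^ weight (tail j \<tau>) * gf (next_level k j c \<tau>))"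
proof (rule fps_ext)
  fix n
  define S where "S = (SIGMA \<tau>:tails k j s c. {\<pi> \<in> next_level k j c \<tau>. weight \<pi> + weight (tail j \<tau>) = n})"
  have big: "2 * j + 2 < part_size x" if "\<pi> \<in> next_level k j c \<tau>" "x \<in> set \<pi>" for \<pi> \<tau> x
  proof -
    obtain u f v where \<tau>: "\<tau> = (u, f, v)" by (cases \<tau>)
    from level_set_size[OF that[unfolded \<tau> next_level_def prod.case]] show ?thesis by simp
  qed
  have mem: "\<pi> @ tail j \<tau> \<in> level_set k j s c \<longleftrightarrow> \<tau> \<in> tails k j s c \<and> \<pi> \<in> next_level k j c \<tau>"
    if "\<And>x. x \<in> set \<pi> \<Longrightarrow> 2 * j + 2 < part_size x" for \<pi> \<tau>
  proof -
    obtain u f v where \<tau>: "\<tau> = (u, f, v)" by (cases \<tau>)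
    have "\<pi> @ tail j (u, f, v) \<in> level_set k j s c \<longleftrightarrow>
      u \<le> 1 \<and> v \<le> 1 \<and> u + f \<le> s \<and> u + f + v + parity_defect k j c (u + f) \<le> k - 1 \<and>
      \<pi> \<in> level_set k (j + 1) (k - 1 - parity_defect k j c (u + f) - f - v) (c + u + v)"
      by (rule append_tail_in_level_set_iff[OF k]) (rule that)
    then show ?thesis
      unfolding \<tau> tails_def next_level_def by simp
  qed
  have "bij_betw (\<lambda>(\<tau>, \<pi>). \<pi> @ tail j \<tau>) S {\<pi> \<in> level_set k j s c. weight \<pi> = n}"
    unfolding bij_betw_def
  proof
    show "inj_on (\<lambda>(\<tau>, \<pi>). \<pi> @ tail j \<tau>) S"
    proof (rule inj_onI)
      fix p p' assume "p \<in> S" "p' \<in> S" and eq': "(\<lambda>(\<tau>, \<pi>). \<pi> @ tail j \<tau>) p = (\<lambda>(\<tau>, \<pi>). \<pi> @ tail j \<tau>) p'"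
      obtain \<tau> \<pi> where p: "p = (\<tau>, \<pi>)" by (cases p)
      obtain \<tau>' \<pi>' where p': "p' = (\<tau>', \<pi>')" by (cases p')
      have b: "\<And>x. x \<in> set \<pi> \<Longrightarrow> 2 * j + 2 < part_size x" "\<And>x. x \<in> set \<pi>' \<Longrightarrow> 2 * j + 2 < part_size x"
        using \<open>p \<in> S\<close> \<open>p' \<in> S\<close> big unfolding S_def p p' by blast+
      have filter: "filter (\<lambda>x. 2 * j + 2 < part_size x) (\<rho> @ tail j \<tau>) = \<rho>"
        if "\<And>x. x \<in> set \<rho> \<Longrightarrow> 2 * j + 2 < part_size x" for \<rho> \<tau>
      proof -
        have "filter (\<lambda>x. 2 * j + 2 < part_size x) (tail j \<tau>) = []"
          using size_tail[of _ j \<tau>] unfolding filter_empty_conv by (meson leD)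
        moreover have "filter (\<lambda>x. 2 * j + 2 < part_size x) \<rho> = \<rho>"
          using that unfolding filter_id_conv by blast
        ultimately show ?thesis by simp
      qed
      have eq: "\<pi> @ tail j \<tau> = \<pi>' @ tail j \<tau>'"
        using eq' by (simp add: p p')
      then have "\<pi> = \<pi>'"
        using filter[of \<pi> \<tau>, OF b(1)] filter[of \<pi>' \<tau>', OF b(2)] by simp
      then show "p = p'"
        using eq tail_inj[of j \<tau> \<tau>'] by (simp add: p p')
    qed
    show "(\<lambda>(\<tau>, \<pi>). \<pi> @ tail j \<tau>) ` S = {\<pi> \<in> level_set k j s c. weight \<pi> = n}"
    proof (intro equalityI subsetI)
      fix \<rho> assume "\<rho> \<in> (\<lambda>(\<tau>, \<pi>). \<pi> @ tail j \<tau>) ` S"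
      then obtain \<tau> \<pi> where *: "\<rho> = \<pi> @ tail j \<tau>" "\<tau> \<in> tails k j s c" "\<pi> \<in> next_level k j c \<tau>"
        "weight \<pi> + weight (tail j \<tau>) = n"
        unfolding S_def by auto
      then show "\<rho> \<in> {\<pi> \<in> level_set k j s c. weight \<pi> = n}"
        using mem[of \<pi> \<tau>] big[of \<pi> \<tau>] by simp
    next
      fix \<rho> assume \<rho>: "\<rho> \<in> {\<pi> \<in> level_set k j s c. weight \<pi> = n}"
      then have "sorted_wrt may_precede \<rho>"
        "\<forall>x\<in>set \<rho>. 2 * j < part_size x \<and> (\<not> overlined x \<longrightarrow> even (part_size x))"
        by (simp_all add: level_set_def)
      then obtain \<pi> u f v where *: "\<rho> = \<pi> @ tail j (u, f, v)" "\<And>x. x \<in> set \<pi> \<Longrightarrow> 2 * j + 2 < part_size x"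
        by (rule exists_tail) (rule that)
      then have "((u, f, v), \<pi>) \<in> S"
        using \<rho> mem[of \<pi> "(u, f, v)"] unfolding S_def by simp
      then show "\<rho> \<in> (\<lambda>(\<tau>, \<pi>). \<pi> @ tail j \<tau>) ` S"
        using *(1) by force
    qed
  qed
  then have "card {\<pi> \<in> level_set k j s c. weight \<pi> = n} = card S"
    by (simp add: bij_betw_same_card)
  also have "\<dots> = (\<Sum>\<tau>\<in>tails k j s c. card {\<pi> \<in> next_level k j c \<tau>. weight \<pi> + weight (tail j \<tau>) = n})"
    unfolding S_def
  proof (rule card_SigmaI[OF finite_tails], rule ballI)
    fix \<tau> assume "\<tau> \<in> tails k j s c"
    have "finite {\<pi> \<in> next_level k j c \<tau>. weight \<pi> = n - weight (tail j \<tau>)}"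
      by (cases \<tau>) (simp add: next_level_def finite_level_set_weight)
    then show "finite {\<pi> \<in> next_level k j c \<tau>. weight \<pi> + weight (tail j \<tau>) = n}"
      by (rule rev_finite_subset) auto
  qed
  also have "\<dots> = (\<Sum>\<tau>\<in>tails k j s c. if n < weight (tail j \<tau>) then 0
     else card {\<pi> \<in> next_level k j c \<tau>. weight \<pi> = n - weight (tail j \<tau>)})"
  proof (intro sum.cong refl)
    fix \<tau>
    have "{\<pi> \<in> next_level k j c \<tau>. weight \<pi> + weight (tail j \<tau>) = n} = (if n < weight (tail j \<tau>) then {}
      else {\<pi> \<in> next_level k j c \<tau>. weight \<pi> = n - weight (tail j \<tau>)})" by auto
    then show "card {\<pi> \<in> next_level k j c \<tau>. weight \<pi> + weight (tail j \<tau>) = n} = (if n < weight (tail j \<tau>) then 0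
      else card {\<pi> \<in> next_level k j c \<tau>. weight \<pi> = n - weight (tail j \<tau>)})" by simp
  qed
  finally show "gf (level_set k j s c) $ n =
    (\<Sum>\<tau>\<in>tails k j s c. q ^ weight (tail j \<tau>) * gf (next_level k j c \<tau>)) $ n"
    by (simp add: gf_def fps_sum_nth fps_X_power_mult_nth if_distrib[of of_nat] cong: if_cong)
qed

text \<open>With this constant, \<open>c + (k - 1) * j\<close> is \<open>s\<close> modulo 2 at every
  level, so the defect of \<open>t\<close> is the parity of \<open>t + s\<close>. The normalisation
  is moreover preserved by removing a tail from \<open>top_tails\<close>.\<close>

definition B_gf :: "nat \<Rightarrow> nat \<Rightarrow> nat \<Rightarrow> rat fps" where
  "B_gf k j s = gf (level_set k j s (s + j * (k - 1)))"

text \<open>Here \<open>u + f\<close> is \<open>s\<close> with defect 0 or \<open>s - 1\<close> with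
  defect 1. In both cases \<open>u + f\<close> plus the defect is \<open>s\<close>, which explains
  the uniform bound \<open>s + v \<le> k - 1\<close>.\<close>

definition top_tails :: "nat \<Rightarrow> nat \<Rightarrow> (nat \<times> nat \<times> nat) set" where
  "top_tails k s = {(u, f, v). u \<le> 1 \<and> v \<le> 1 \<and> u + f \<le> s \<and> s \<le> u + f + 1 \<and> s + v \<le> k - 1}"

lemma top_tails_cases:
  assumes "x \<in> top_tails k s"
  obtains u f v where "x = (u, f, v)" "u = 0 \<or> u = 1" "v = 0 \<or> v = 1" "u + f = s \<or> Suc (u + f) = s" "s + v \<le> k - 1"
proof -
  obtain u f v where x: "x = (u, f, v)" by (cases x)
  show ?thesis
    by (rule that[OF x]) (use assms in \<open>auto simp: top_tails_def x\<close>)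
qed

lemma top_tails_0: "k > 2 \<Longrightarrow> top_tails k 0 = {(0, 0, 0), (0, 0, 1)}"
  by (auto simp: top_tails_def)

lemma top_tails_1:
  assumes "1 < k - 1"
  shows "top_tails k 1 = {(0, 1, 0), (0, 1, 1), (1, 0, 0), (1, 0, 1), (0, 0, 0), (0, 0, 1)}" (is "_ = ?R")
proof
  show "top_tails k 1 \<subseteq> ?R"
    by (rule subsetI, erule top_tails_cases, elim disjE) simp_all
  show "?R \<subseteq> top_tails k 1"
    unfolding top_tails_def insert_subset using assms by simp
qed

lemma top_tails_less:
  assumes "t + 2 < k - 1"
  shows "top_tails k (t + 2) = {(0, t + 2, 0), (0, t + 2, 1), (1, t + 1, 0), (1, t + 1, 1),
           (0, t + 1, 0), (0, t + 1, 1), (1, t, 0), (1, t, 1)}" (is "_ = ?R")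
proof
  show "top_tails k (t + 2) \<subseteq> ?R"
    by (rule subsetI, erule top_tails_cases, elim disjE) simp_all
  show "?R \<subseteq> top_tails k (t + 2)"
    unfolding top_tails_def insert_subset using assms by simp
qed

lemma top_tails_max:
  assumes "k - 1 = t + 2"
  shows "top_tails k (t + 2) = {(0, t + 2, 0), (1, t + 1, 0), (0, t + 1, 0), (1, t, 0)}" (is "_ = ?R")
proof
  show "top_tails k (t + 2) \<subseteq> ?R"
    by (rule subsetI, erule top_tails_cases, elim disjE) (use assms in simp_all)
  show "?R \<subseteq> top_tails k (t + 2)"
    unfolding top_tails_def insert_subset using assms by simp
qed
text \<open>Tails with \<open>u + f \<le> s - 2\<close> are precisely those for
  \<open>s - 2\<close>, with the same parity constant modulo 2. For the others, \<open>u + f\<close>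
  plus the defect equals \<open>s\<close>, so the next bound is \<open>k - 1 - s - v + u\<close>;
  the constant \<open>c + u + v\<close> differs from its normalised value at the next level by twice
  \<open>k - 1 - s - v\<close>.\<close>

lemma B_gf_recurrence:
  assumes k: "k > 2"
  shows "B_gf k j s = (if s \<ge> 2 then B_gf k j (s - 2) else 0) +
    (\<Sum>(u, f, v)\<in>top_tails k s. q ^ weight (tail j (u, f, v)) * B_gf k (j + 1) (k - 1 - s - v + u))"
proof -
  define c where "c = s + j * (k - 1)"
  have \<delta>: "parity_defect k j c t = (if even (t + s) then 0 else 1)" for t
  proof -
    have "[t = c + (k - 1) * j] (mod 2) \<longleftrightarrow> even (t + s)"
      by (simp add: cong_def c_def even_iff_mod_2_eq_zero mult.commute[of j] add.assoc flip: mult_2) presburger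
    then show ?thesis by (simp add: parity_defect_def)
  qed
  define low where "low = (if s \<ge> 2 then tails k j (s - 2) c else {})"
  have split: "tails k j s c = low \<union> top_tails k s" "low \<inter> top_tails k s = {}"
  proof -
    have "(u, f, v) \<in> tails k j s c \<longleftrightarrow> (u, f, v) \<in> low \<union> top_tails k s" for u f v
    proof (cases "s \<le> u + f + 1")
      case True
      then have "(u, f, v) \<notin> low" by (auto simp: low_def tails_def)
      moreover have "u + f + v + (if even (u + f + s) then 0 else 1) \<le> k - 1 \<longleftrightarrow> s + v \<le> k - 1" if "u + f \<le> s"
      proof -
        have "u + f = s \<or> s = Suc (u + f)" using True that by auto
        then show ?thesis by auto
      qed
      ultimately show ?thesis using True by (auto simp: tails_def top_tails_def \<delta>)
    next
      case False
      then show ?thesis by (auto simp: tails_def top_tails_def low_def)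
    qed
    then show "tails k j s c = low \<union> top_tails k s" by auto
    show "low \<inter> top_tails k s = {}" by (auto simp: low_def tails_def top_tails_def)
  qed
  have fin: "finite low" "finite (top_tails k s)"
    using finite_tails[of k j s c] split(1) by auto
  have "B_gf k j s = (\<Sum>\<tau>\<in>low. q ^ weight (tail j \<tau>) * gf (next_level k j c \<tau>)) +
     (\<Sum>\<tau>\<in>top_tails k s. q ^ weight (tail j \<tau>) * gf (next_level k j c \<tau>))"
    unfolding B_gf_def c_def[symmetric] gf_level_set[OF k] split(1) by (rule sum.union_disjoint[OF fin split(2)])
  also have "(\<Sum>\<tau>\<in>low. q ^ weight (tail j \<tau>) * gf (next_level k j c \<tau>)) = (if s \<ge> 2 then B_gf k j (s - 2) else 0)"
  proof (cases "s \<ge> 2")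
    case True
    then have "[c = s - 2 + j * (k - 1)] (mod 2)"
      unfolding c_def by (intro cong_add cong_refl) (simp add: cong_def mod2_eq_if)
    then have "level_set k j (s - 2) (s - 2 + j * (k - 1)) = level_set k j (s - 2) c"
      by (rule level_set_cong[symmetric])
    then show ?thesis using True by (simp add: B_gf_def low_def gf_level_set[OF k])
  qed (simp add: low_def)
  also have "(\<Sum>\<tau>\<in>top_tails k s. q ^ weight (tail j \<tau>) * gf (next_level k j c \<tau>)) =
    (\<Sum>(u, f, v)\<in>top_tails k s. q ^ weight (tail j (u, f, v)) * B_gf k (j + 1) (k - 1 - s - v + u))"
  proof (rule sum.cong[OF refl], clarify)
    fix u f v assume *: "(u, f, v) \<in> top_tails k s"
    then obtain e where e: "k - 1 = s + v + e" unfolding top_tails_def by (auto simp: le_iff_add)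
    have t: "k - 1 - parity_defect k j c (u + f) - f - v = k - 1 - s - v + u"
    proof -
      have "u + f = s \<or> s = Suc (u + f)" using * by (auto simp: top_tails_def)
      then show ?thesis unfolding e \<delta> by auto
    qed
    have "[c + u + v = k - 1 - s - v + u + (j + 1) * (k - 1)] (mod 2)"
    proof -
      have "k - 1 - s - v + u + (j + 1) * (k - 1) = c + u + v + 2 * e"
        unfolding c_def e by (simp add: algebra_simps)
      then show ?thesis by (simp only:) (simp add: cong_def)
    qed
    then have "next_level k j c (u, f, v) = level_set k (j + 1) (k - 1 - s - v + u) (k - 1 - s - v + u + (j + 1) * (k - 1))"
      unfolding next_level_def prod.case t by (rule level_set_cong)
    then show "q ^ weight (tail j (u, f, v)) * gf (next_level k j c (u, f, v)) =
       q ^ weight (tail j (u, f, v)) * B_gf k (j + 1) (k - 1 - s - v + u)"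
      by (simp only: B_gf_def)
  qed
  finally show ?thesis .
qed

lemma B_gf_agree_1: "agree j (B_gf k j s) 1"
  unfolding agree_def
proof (intro allI impI)
  fix n assume n: "n < j"
  have "{\<pi> \<in> level_set k j s c. weight \<pi> = n} = (if n = 0 then {[]} else {})" for c
  proof -
    have "\<pi> = []" if "\<pi> \<in> level_set k j s c" "weight \<pi> = n" for \<pi>
    proof (rule ccontr)
      assume "\<pi> \<noteq> []"
      then obtain x where x: "x \<in> set \<pi>" by (cases \<pi>) auto
      have "2 * j < part_size x" using level_set_size[OF that(1) x] .
      moreover have "part_size x \<le> weight \<pi>"
        using x member_le_sum_list[of "part_size x" "map part_size \<pi>"] by auto
      ultimately show False using n that(2) by simp
    qed
    moreover have "[] \<in> level_set k j s c" by (simp add: level_set_def windows_ok_def)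
    ultimately have "\<pi> \<in> level_set k j s c \<and> weight \<pi> = n \<longleftrightarrow> \<pi> = [] \<and> n = 0" for \<pi>
      by (metis list.simps(8) sum_list.Nil)
    then show ?thesis by (simp add: Collect_conv_if)
  qed
  then show "B_gf k j s $ n = 1 $ n" by (simp add: B_gf_def gf_def)
qed

text \<open>
  The minimum reflects that \<open>r = k\<close> and \<open>r = k - 1\<close> give the same generating function.
\<close>
definition product_gf :: "nat \<Rightarrow> nat \<Rightarrow> nat \<Rightarrow> rat fps" where
  "product_gf k j s = even_prod j * gollnitz (k - 2) (min s (k - 2)) j"

lemma weight_tail: "q ^ weight (tail j (u, f, v)) = (q ^ (2 * j + 1)) ^ u * (q ^ (2 * j + 2)) ^ (f + v)"
  by (simp add: tail_def sum_list_replicate power_mult[symmetric] power_add[symmetric] algebra_simps)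

text \<open>For \<open>2 \<le> s \<le> k - 2\<close>, two steps of \<open>gollnitz_Suc\<close> lead
  from \<open>s - 2\<close> to \<open>s\<close> and produce four terms, one for each choice of
  \<open>u\<close> and \<open>v\<close>. The factor \<open>1 + y\<close> from
  \<open>even_prod\<close> doubles each of them: given \<open>u\<close> and \<open>v\<close>, the
  tails with \<open>u + f = s - 1\<close> and \<open>u + f = s\<close> lead to the same next index
  and differ by one part \<open>2 j + 2\<close>.\<close>

lemma product_gf_recurrence:
  assumes k: "k > 2" and s: "s \<le> k - 1"
  shows "product_gf k j s = (if s \<ge> 2 then product_gf k j (s - 2) else 0) +
    (\<Sum>(u, f, v)\<in>top_tails k s. q ^ weight (tail j (u, f, v)) * product_gf k (j + 1) (k - 1 - s - v + u))"
proof -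
  define y where "y = q ^ (2 * j + 2)"
  define z where "z = q ^ (2 * j + 1)"
  define L where "L = k - 2"
  have kL: "k = L + 2" "L \<ge> 1" using k by (auto simp: L_def)
  define p' where "p' = even_prod (j + 1)"
  define g where "g = (\<lambda>i. gollnitz L i (j + 1))"
  have p: "even_prod j = (1 + y) * p'"
    using even_prod_Suc[of j] by (simp add: y_def p'_def)
  have F': "product_gf k (j + 1) t = p' * g (min t L)" for t
    by (simp add: product_gf_def p'_def g_def L_def)
  have F: "product_gf k j t = (1 + y) * p' * gollnitz L (min t L) j" for t
    by (simp only: product_gf_def p L_def)
  have G0: "gollnitz L 0 j = g L"
    by (simp add: gollnitz_0 g_def)
  have GS: "gollnitz L (Suc t) j = gollnitz L t j + y ^ Suc t * g (L - Suc t) + y ^ t * z * g (L - t)"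
    if "Suc t \<le> L" for t
  proof -
    have e: "2 * (j + 1) * Suc t = (2 * j + 2) * Suc t" "2 * (j + 1) * t + 2 * j + 1 = (2 * j + 2) * t + (2 * j + 1)"
      by simp_all
    show ?thesis
      unfolding gollnitz_Suc[OF that] e power_add[of q "(2 * j + 2) * t" "2 * j + 1"] power_mult y_def z_def g_def
      by simp
  qed
  have "(1 + y) * p' * gollnitz L (min s L) j =
      (if s \<ge> 2 then (1 + y) * p' * gollnitz L (min (s - 2) L) j else 0) +
      (\<Sum>(u, f, v)\<in>top_tails k s. z ^ u * y ^ (f + v) * (p' * g (min (k - 1 - s - v + u) L)))"
  proof -
    consider "s = 0" | "s = 1" | t where "s = t + 2" "t + 2 \<le> L" | t where "s = t + 2" "L = t + 1"
    proof -
      have "s = 0 \<or> s = 1 \<or> s = (s - 2) + 2" by linarith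
      moreover have "s - 2 + 2 \<le> L \<or> L = s - 2 + 1" if "s = (s - 2) + 2" using that s kL(1) by linarith
      ultimately show thesis using that by metis
    qed
    then show ?thesis
    proof cases
      \<comment> \<open>With \<open>s = 0\<close> there is no choice for \<open>u + f\<close>;
        instead \<open>v = 0\<close> and \<open>v = 1\<close> supply the factor
        \<open>1 + y\<close>, since their next indices \<open>k - 1\<close> and \<open>k - 2\<close>
        have the same minimum with \<open>L\<close>.\<close>
      case 1
      show ?thesis
        unfolding 1 top_tails_0[OF k] using kL by (simp add: G0 algebra_simps)
    next
      \<comment> \<open>The tails with \<open>u = 0\<close> pair by \<open>f\<close>. Those with
        \<open>u = 1\<close> all have \<open>f = 0\<close> and pair by \<open>v\<close>, again
        because the minimum with \<open>L\<close> identifies the two next indices.\<close>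
      case 2
      have "1 < k - 1" using kL by simp
      note sum = top_tails_1[OF this]
      have g1: "gollnitz L 1 j = g L + y * g (L - 1) + z * g L"
        using GS[of 0] kL(2) by (simp add: G0)
      have m: "min (k - 1 - 1 - 0 + 0) L = L" "min (k - 1 - 1 - 1 + 0) L = L - 1"
        "min (k - 1 - 1 - 0 + 1) L = L" "min (k - 1 - 1 - 1 + 1) L = L" "min 1 L = 1"
        using kL by auto
      have "(\<Sum>(u, f, v)\<in>top_tails k 1. z ^ u * y ^ (f + v) * (p' * g (min (k - 1 - 1 - v + u) L))) =
        y * (p' * g L) + (y * y * (p' * g (L - 1)) + (z * (p' * g L) + (z * y * (p' * g L) + (p' * g L + y * (p' * g (L - 1))))))"
        unfolding sum by (simp add: m[simplified] power2_eq_square)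
      then show ?thesis
        unfolding 2 m(5) g1 by (simp add: algebra_simps)
    next
      case (3 t)
      define e where "e = L - (t + 2)"
      have L: "L = t + 2 + e" using 3 by (simp add: e_def)
      have "t + 2 < k - 1" using kL L by simp
      note sum = top_tails_less[OF this]
      have m: "min (k - 1 - (t + 2) - 0 + 0) L = e + 1" "min (k - 1 - (t + 2) - 1 + 0) L = e"
        "min (k - 1 - (t + 2) - 0 + 1) L = e + 2" "min (k - 1 - (t + 2) - 1 + 1) L = e + 1"
        "min (t + 2) L = t + 2" "min (t + 2 - 2) L = t"
        using kL L by auto
      have "(\<Sum>(u, f, v)\<in>top_tails k (t + 2). z ^ u * y ^ (f + v) * (p' * g (min (k - 1 - (t + 2) - v + u) L))) =
        y ^ (t + 2) * (p' * g (e + 1)) + (y ^ (t + 3) * (p' * g e) + (z * y ^ (t + 1) * (p' * g (e + 2)) +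
        (z * y ^ (t + 2) * (p' * g (e + 1)) + (y ^ (t + 1) * (p' * g (e + 1)) + (y ^ (t + 2) * (p' * g e) +
        (z * y ^ t * (p' * g (e + 2)) + z * y ^ (t + 1) * (p' * g (e + 1))))))))"
        unfolding sum by (simp add: m[simplified] numeral_3_eq_3)
      moreover have "gollnitz L (t + 2) j = gollnitz L t j + y ^ (t + 1) * g (e + 1) + y ^ t * z * g (e + 2) +
         y ^ (t + 2) * g e + y ^ (t + 1) * z * g (e + 1)"
      proof -
        have "L - Suc t = e + 1" "L - t = e + 2" "L - Suc (Suc t) = e" using L by auto
        then show ?thesis using GS[of t] GS[of "Suc t"] L by simp
      qed
      ultimately show ?thesis
        unfolding 3(1) m(5,6) by (simp add: algebra_simps numeral_3_eq_3)
    next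
      \<comment> \<open>At \<open>s = k - 1\<close> the bound \<open>s + v \<le> k - 1\<close>
        excludes \<open>v = 1\<close>, which leaves two pairs of tails. Correspondingly the minimum
        turns \<open>s\<close> into \<open>s - 1\<close>, and a single step from
        \<open>s - 2\<close> suffices.\<close>
      case (4 t)
      have "k - 1 = t + 2" using kL 4 by simp
      note sum = top_tails_max[OF this]
      have m: "min (k - 1 - (t + 2) - 0 + 0) L = 0" "min (k - 1 - (t + 2) - 0 + 1) L = 1"
        "min (t + 2) L = t + 1" "min (t + 2 - 2) L = t"
        using kL 4 by auto
      have "(\<Sum>(u, f, v)\<in>top_tails k (t + 2). z ^ u * y ^ (f + v) * (p' * g (min (k - 1 - (t + 2) - v + u) L))) =
        y ^ (t + 2) * (p' * g 0) + (z * y ^ (t + 1) * (p' * g 1) + (y ^ (t + 1) * (p' * g 0) + z * y ^ t * (p' * g 1)))"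
        unfolding sum by (simp add: m[simplified])
      moreover have "gollnitz L (t + 1) j = gollnitz L t j + y ^ (t + 1) * g 0 + y ^ t * z * g 1"
        using GS[of t] 4 by simp
      ultimately show ?thesis
        unfolding 4(1) m(3,4) by (simp add: algebra_simps)
    qed
  qed
  then show ?thesis
    unfolding weight_tail F' F y_def[symmetric] z_def[symmetric] .
qed

lemma product_gf_agree_1: "agree j (product_gf k j s) 1"
  unfolding product_gf_def by (intro agree_mult_1 even_prod_agree_1 gollnitz_agree_1)

text \<open>Once \<open>j \<ge> M\<close> both sides are 1 modulo \<open>q ^ M\<close>. Below that,
  the outer induction on a bound \<open>d\<close> for \<open>M - j\<close> handles the terms of
  level \<open>j + 1\<close>, and the inner strong induction on \<open>s\<close> handles the term at
  \<open>s - 2\<close> of the same level.\<close>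

lemma B_gf_eq_product_gf:
  assumes k: "k > 2" and s: "s \<le> k - 1"
  shows "B_gf k j s = product_gf k j s"
proof (rule agree_imp_eq)
  fix M
  have "agree M (B_gf k j s) (product_gf k j s)" if "M \<le> j + d" "s \<le> k - 1" for d j s
    using that
  proof (induction d arbitrary: j s)
    case 0
    then show ?case
      using agree_mono[OF B_gf_agree_1, of M j] agree_mono[OF product_gf_agree_1, of M j]
      by (metis add_0_right agree_sym agree_trans)
  next
    case (Suc d)
    note IH = Suc.IH
    show ?case
      using Suc.prems
    proof (induction s rule: less_induct)
      case (less s)
      have "agree M (if s \<ge> 2 then B_gf k j (s - 2) else 0) (if s \<ge> 2 then product_gf k j (s - 2) else 0)"
        using less.IH[of "s - 2"] less.prems by auto
      moreover have "agree M (q ^ weight (tail j (u, f, v)) * B_gf k (j + 1) (k - 1 - s - v + u))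
         (q ^ weight (tail j (u, f, v)) * product_gf k (j + 1) (k - 1 - s - v + u))"
        if "(u, f, v) \<in> top_tails k s" for u f v
      proof (intro agree_mult agree_refl IH)
        show "M \<le> j + 1 + d" using less.prems by simp
        show "k - 1 - s - v + u \<le> k - 1" using that by (auto simp: top_tails_def)
      qed
      ultimately show ?case
        unfolding B_gf_recurrence[OF k, of j s] product_gf_recurrence[OF k less.prems(2), of j]
        by (intro agree_add agree_sum) auto
    qed
  qed
  from this[of j M s] s show "agree M (B_gf k j s) (product_gf k j s)" by simp
qed

section \<open>Matching residue classes and coefficients\<close>

text \<open>Since \<open>a + c = 4 k - 4\<close>, the residues of \<plusminus>(2r - 1) are
  \<open>a\<close> and \<open>c\<close> in some order: \<open>2 r - 1\<close> is \<open>a\<close>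
  for \<open>r < k\<close> and \<open>c\<close> for \<open>r = k\<close>, where \<open>s\<close>
  stays at \<open>k - 2\<close>.\<close>

lemma A_allowed_iff:
  fixes k r m :: nat
  assumes "k > 2" "k \<ge> r" "r \<ge> 1"
  defines "s \<equiv> min (r - 1) (k - 2)"
  defines "a \<equiv> 2 * s + 1" and "c \<equiv> 4 * (k - 2 - s) + 2 * s + 3"
  shows "\<not> [int m = 2] (mod 4) \<and> \<not> [int m = 0] (mod (4 * int k - 4)) \<and>
        \<not> [int m = 2 * int r - 1] (mod (4 * int k - 4)) \<and>
        \<not> [int m = - (2 * int r - 1)] (mod (4 * int k - 4)) \<longleftrightarrow>
     m mod 4 \<noteq> 2 \<and> m mod (a + c) \<notin> {0, a, c}"
proof -
  have b: "4 * int k - 4 = int (a + c)"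
    using assms(1) by (auto simp: a_def c_def s_def min_def)
  have ac: "a < a + c" "c < a + c" by (simp_all add: a_def c_def)
  have cong: "[int m = int x] (mod int (a + c)) \<longleftrightarrow> m mod (a + c) = x" if "x < a + c" for x
    unfolding cong_int_iff using that by (simp add: cong_def)
  have two: "[int m = 2] (mod 4) \<longleftrightarrow> m mod 4 = 2"
    using cong_int_iff[of m 2 4] by (simp add: cong_def)
  have zero: "[int m = 0] (mod int (a + c)) \<longleftrightarrow> m mod (a + c) = 0"
    using cong[of 0] ac by simp
  have neg: "[int m = - int x] (mod int (a + c)) \<longleftrightarrow> m mod (a + c) = a + c - x" if "0 < x" "x < a + c" for x
  proof -
    have "- int x - int (a + c - x) = - int (a + c)"
      using that by simp
    then have "[- int x = int (a + c - x)] (mod int (a + c))"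
      unfolding cong_iff_dvd_diff by (simp only: dvd_minus_iff dvd_refl)
    then have "[int m = - int x] (mod int (a + c)) \<longleftrightarrow> [int m = int (a + c - x)] (mod int (a + c))"
      by (meson cong_sym cong_trans)
    then show ?thesis using cong[of "a + c - x"] that by simp
  qed
  define x where "x = 2 * r - 1"
  have x: "2 * int r - 1 = int x" "0 < x" using assms(3) by (simp_all add: x_def)
  have "x = a \<or> x = c"
    using assms(1-3) unfolding x_def a_def c_def s_def by (cases "r = k") (auto simp: min_def)
  then show ?thesis
    unfolding b two zero x(1) using cong[of x] neg[of x] ac x(2) by auto
qed

lemma A_bar_eq_coeff_product_gf:
  assumes "k > 2" "k \<ge> r" "r \<ge> 1"
  shows "of_nat (A_bar k r n) = product_gf k 0 (r - 1) $ n"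
proof -
  define s where "s = min (r - 1) (k - 2)"
  define a where "a = 2 * s + 1"
  define c where "c = 4 * (k - 2 - s) + 2 * s + 3"
  \<comment> \<open>The bound \<open>(a + c) * n\<close> on part sizes admits every part of an
    overpartition of \<open>n\<close> and consists of whole periods, as the product formula
    requires.\<close>
  have "1 * n \<le> (a + c) * n" by (intro mult_right_mono) (simp_all add: a_def)
  then have "of_nat (A_bar k r n) = gf (overpartitions_in {(m, b). 0 < m \<and> m \<le> (a + c) * n \<and>
     (if b then even m else m mod 4 \<noteq> 2 \<and> m mod (a + c) \<notin> {0, a, c})}) $ n"
    by (subst A_bar_eq_coeff[of n "(a + c) * n"])
      (simp_all only: A_allowed_iff[OF assms, folded s_def, folded a_def c_def] mult_1)
  also have "\<dots> = (\<Prod>m<(a + c) * n. (if even (m + 1) then 1 + q ^ (m + 1) else 1) *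
      (if (m + 1) mod 4 \<noteq> 2 \<and> (m + 1) mod (a + c) \<notin> {0, a, c} then inverse (1 - q ^ (m + 1)) else 1)) $ n"
    by (subst gf_overpartitions_in_bounded) (rule refl)
  also have "\<dots> = (even_prod 0 * ((1 + q) * ratio_prod 1 * fps_series (theta_term (k - 2 - s) s))) $ n"
    by (rule agree_nth[OF A_product_agree[OF a_def c_def]]) simp
  also have "\<dots> = product_gf k 0 (r - 1) $ n"
    by (simp only: product_gf_def gollnitz_level_0 s_def)
  finally show ?thesis .
qed

theorem theorem1p20:
  fixes k r n :: nat
  assumes "k > 2" and "k \<ge> r" and "r \<ge> 1"
  shows "A_bar k r n = B_bar k r n"
proof -
  have "of_nat (A_bar k r n) = product_gf k 0 (r - 1) $ n"
    by (rule A_bar_eq_coeff_product_gf[OF assms])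
  also have "\<dots> = B_gf k 0 (r - 1) $ n"
    using assms by (subst B_gf_eq_product_gf) auto
  also have "\<dots> = of_nat (B_bar k r n)"
    by (simp add: B_gf_def gf_def B_bar_def B_bar_set_eq_level_set[OF assms(1)])
  finally show ?thesis by simp
qed

end
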